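(* Let $F\subset S^{2n-1}$ be nonempty. The suspension $S^X_0(F)$ is a formal Forelli suspension if and only if it has a nonsparse leaf.
   Context: Fix $n\ge1$ and $\lambda=(\lambda_1,\dots,\lambda_n)$ with $\lambda_1=1$, $\lambda_k>0$ for all $k$. For $z\in\mathbb{C}^n$, $t\in\mathbb{C}$ put $\Phi^X(z,t)=(z_1e^{-\lambda_1t},\dots,z_ne^{-\lambda_nt})$; $\mathbb{H}=\{\operatorname{Re}t>0\}$; $B^n$ the open unit ball, $S^{2n-1}$ its boundary. $S^X_0(F)=\{\Phi^X(z,t):z\in F,t\in\mathbb{H}\}$; for $z\in\bar F$ (closure in $S^{2n-1}$) its leaf is $L_z=\{\Phi^X(z,t):t\in\mathbb{H}\}$. A polynomial $q\in\mathbb{C}[z,\bar z]$ is quasi-homogeneous of type $\lambda$ with bidegree $(d_1,d_2)$ if $q(\Phi^X(z,t))=e^{-d_1t}e^{-d_2\bar t}q(z)$ for all $t\in\mathbb{H}$, $z\in\mathbb{C}^n$; $\mathcal{H}_\lambda$ is the set of such polynomials. The leaf $L_z$, $z\in\bar F$, is nonsparse if for every open neighborhood $U\subset S^{2n-1}$ of $z$ and every $q\in\mathcal{H}_\lambda$ of bidegree $(d_1,d_2)$ with $d_2\ne0$ and $\bar F\cap U\subset\{q=0\}$, one has $q\equiv0$ on $\mathbb{C}^n$. $S^X_0(F)$ is a formal Forelli suspension if every $f:B^n\to\mathbb{C}$ with (1) $f\in C^\infty(0)$ (for each $k$, $f$ is $C^k$ on some neighborhood of $0$) and (2) $t\in\mathbb{H}\mapsto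 f(\Phi^X(z,t))$ holomorphic for each $z\in F$, has formal Taylor series $\sum a_{km}z^k\bar z^m$, $a_{km}=\frac{1}{k!m!}\frac{\partial^{|k|+|m|}f}{\partial z^k\partial\bar z^m}(0)$, with $a_{km}=0$ whenever $m\ne0$. *)

theory Defs
  imports "HOL-Analysis.Analysis"
begin

definition PhiX :: "real^'n \<Rightarrow> complex^'n \<Rightarrow> complex \<Rightarrow> complex^'n" where
  "PhiX lam z t = (\<chi> i. z $ i * exp (- (complex_of_real (lam $ i)) * t))"

definition right_half_plane :: "complex set" where
  "right_half_plane = {t. 0 < Re t}"

definition pd :: "complex^'n \<Rightarrow> (complex^'n \<Rightarrow> complex) \<Rightarrow> complex^'n \<Rightarrow> complex" where
  "pd v g z = vector_derivative (\<lambda>s::real. g (z + s *\<^sub>R v)) (at 0)"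

definition dz :: "'n \<Rightarrow> (complex^'n \<Rightarrow> complex) \<Rightarrow> complex^'n \<Rightarrow> complex" where
  "dz j g z = (pd (axis j 1) g z - \<i> * pd (axis j \<i>) g z) / 2"

definition dzbar :: "'n \<Rightarrow> (complex^'n \<Rightarrow> complex) \<Rightarrow> complex^'n \<Rightarrow> complex" where
  "dzbar j g z = (pd (axis j 1) g z + \<i> * pd (axis j \<i>) g z) / 2"

text \<open>A fixed enumeration of the coordinate indices (the order is irrelevant for C^N functions).\<close>
definition enum_idx :: "'n::finite list" where
  "enum_idx = (SOME xs. distinct xs \<and> set xs = UNIV)"

definition wirt_iter :: "('n::finite \<Rightarrow> nat) \<Rightarrow> ('n \<Rightarrow> nat) \<Rightarrow> (complex^'n \<Rightarrow> complex) \<Rightarrow> complex^'n \<Rightarrow> complex" where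
  "wirt_iter k m g = foldr (\<lambda>j h. (dz j ^^ k j) h) enum_idx
                        (foldr (\<lambda>j h. (dzbar j ^^ m j) h) enum_idx g)"

definition taylor_coeff :: "(complex^'n::finite \<Rightarrow> complex) \<Rightarrow> ('n \<Rightarrow> nat) \<Rightarrow> ('n \<Rightarrow> nat) \<Rightarrow> complex" where
  "taylor_coeff f k m = wirt_iter k m f 0 / of_nat (\<Prod>j\<in>UNIV. fact (k j) * fact (m j))"

fun Ck_on :: "nat \<Rightarrow> (complex^'n) set \<Rightarrow> (complex^'n \<Rightarrow> complex) \<Rightarrow> bool" where
  "Ck_on 0 U g = continuous_on U g"
| "Ck_on (Suc k) U g = (g differentiable_on U \<and> (\<forall>v. Ck_on k U (pd v g)))"

definition smooth_at0 :: "(complex^'n \<Rightarrow> complex) \<Rightarrow> bool" where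
  "smooth_at0 f = (\<forall>k. \<exists>U. open U \<and> 0 \<in> U \<and> U \<subseteq> ball 0 1 \<and> Ck_on k U f)"

definition zzbar_poly :: "(complex^'n::finite \<Rightarrow> complex) \<Rightarrow> bool" where
  "zzbar_poly q = (\<exists>S c. finite (S :: (('n \<Rightarrow> nat) \<times> ('n \<Rightarrow> nat)) set) \<and>
      (\<forall>z. q z = (\<Sum>(k,m)\<in>S. c (k,m) * (\<Prod>i\<in>UNIV. z $ i ^ k i * cnj (z $ i) ^ m i))))"

definition quasi_hom :: "real^'n \<Rightarrow> (complex^'n \<Rightarrow> complex) \<Rightarrow> real \<Rightarrow> real \<Rightarrow> bool" where
  "quasi_hom lam q d1 d2 = (\<forall>t\<in>right_half_plane. \<forall>z.
      q (PhiX lam z t) = exp (- of_real d1 * t) * exp (- of_real d2 * cnj t) * q z)"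

definition nonsparse_leaf :: "real^'n::finite \<Rightarrow> (complex^'n) set \<Rightarrow> complex^'n \<Rightarrow> bool" where
  "nonsparse_leaf lam F z = (\<forall>U q d1 d2.
      openin (top_of_set (sphere 0 1)) U \<and> z \<in> U \<and>
      zzbar_poly q \<and> quasi_hom lam q d1 d2 \<and> d2 \<noteq> 0 \<and>
      closure F \<inter> U \<subseteq> {w. q w = 0} \<longrightarrow> (\<forall>w. q w = 0))"

definition formal_forelli :: "real^'n::finite \<Rightarrow> (complex^'n) set \<Rightarrow> bool" where
  "formal_forelli lam F = (\<forall>f. smooth_at0 f \<longrightarrow>
      (\<forall>z\<in>F. (\<lambda>t. f (PhiX lam z t)) holomorphic_on right_half_plane) \<longrightarrow>
      (\<forall>k m. m \<noteq> (\<lambda>_. 0) \<longrightarrow> taylor_coeff f k m = 0))"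

end

theory Submission
  imports Defs "HOL-Complex_Analysis.Cauchy_Integral_Formula"
begin

text \<open>
  Along a leaf, Taylor's formula becomes an expansion in the exponentials
  \<open>exp (- d1 t) exp (- d2 cnj t)\<close>, the coefficient of which is the quasi-homogeneous part
  of bidegree \<open>(d1, d2)\<close> of the Taylor polynomial. If \<open>f\<close> is holomorphic on the leaf, then its
  lowest non-holomorphic terms are a trigonometric polynomial in \<open>Im t\<close> that is a limit of
  holomorphic functions, so it is constant and all parts with \<open>d2 \<noteq> 0\<close> vanish on \<open>F\<close>; a single
  nonsparse leaf makes them vanish identically. Conversely, if no leaf is nonsparse, compactness
  of the closure of \<open>F\<close> gives finitely many nonzero quasi-homogeneous polynomials whose product
  vanishes on \<open>F\<close>. This product is a nonzero polynomial which is zero on all leaves, and its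
  bidegree has \<open>d2 > 0\<close>, so it is not formally holomorphic.
\<close>

section \<open>Directional and Wirtinger derivatives\<close>

text \<open>The modulus of \<open>biexp d1 d2\<close> sees only d1 + d2, so decay along a leaf
  cannot separate bidegrees of equal total weight, and the holomorphic terms (d2 = 0) may be larger
  than the terms of interest. Hence the holomorphic terms are subtracted; multiplication by exp (W
  t), W being the least total weight that remains, turns the terms of weight W into oscillations in
  \<open>Im t\<close> of frequency 2 d2, which is never 0. This is
  \<open>holomorphic_biexp_expansion\<close>. Besides its use for f on a leaf, it is applied to the
  zero function, to compare coefficients of polynomials and to obtain d2 >= 0, and to a Taylor
  polynomial in the converse. The function f need not be given by its Taylor series and is C^k only
  on a neighborhood that may shrink with k, so the Taylor order is fixed beforehand from d1 + d2. In
  the converse, the definition admits any real d2; without d2 >= 0 for nonzero polynomials, the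
  bidegrees of the factors could cancel in the product.\<close>

lemma has_derivative_line:
  fixes g :: "complex^'n \<Rightarrow> complex"
  assumes "(g has_derivative g') (at (a + s *\<^sub>R u))"
  shows "((\<lambda>s. g (a + s *\<^sub>R u)) has_vector_derivative g' u) (at s)"
proof -
  have l: "((\<lambda>s. a + s *\<^sub>R u) has_derivative (\<lambda>h. h *\<^sub>R u)) (at s)"
    by (auto intro!: derivative_eq_intros)
  have "((\<lambda>s. g (a + s *\<^sub>R u)) has_derivative (\<lambda>h. g' (h *\<^sub>R u))) (at s)"
    using has_derivative_compose[OF l assms] by simp
  moreover have "g' (h *\<^sub>R u) = h *\<^sub>R g' u" for h
    using has_derivative_bounded_linear[OF assms] by (simp add: linear_simps)
  ultimately show ?thesis
    by (simp add: has_vector_derivative_def)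
qed

lemma pd_eq_derivative:
  assumes "(g has_derivative g') (at x)"
  shows "pd u g x = g' u"
  using has_derivative_line[of g g' x 0 u] assms
  unfolding pd_def by (auto intro: vector_derivative_at)

lemma pd_line:
  assumes "g differentiable at (a + s *\<^sub>R u)"
  shows "((\<lambda>s. g (a + s *\<^sub>R u)) has_vector_derivative pd u g (a + s *\<^sub>R u)) (at s)"
  using assms has_derivative_line pd_eq_derivative unfolding differentiable_def by metis

lemma pd_cong:
  assumes "open U" "x \<in> U" "\<And>y. y \<in> U \<Longrightarrow> g y = h y"
  shows "pd v g x = pd v h x"
proof -
  have "open ((\<lambda>s::real. x + s *\<^sub>R v) -` U)"
    by (intro open_vimage assms(1) continuous_intros)
  then have "\<forall>\<^sub>F s in nhds (0::real). x + s *\<^sub>R v \<in> U"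
    using assms(2) by (subst eventually_nhds, intro exI[of _ "(\<lambda>s::real. x + s *\<^sub>R v) -` U"]) simp
  then have "\<forall>\<^sub>F s in nhds (0::real). g (x + s *\<^sub>R v) = h (x + s *\<^sub>R v)"
    by eventually_elim (rule assms(3))
  then show ?thesis
    unfolding pd_def by (intro vector_derivative_cong_eq) (auto simp: eventually_nhds)
qed

section \<open>Mean value estimates and mixed second differences\<close>

lemma norm_mvt_segment:
  fixes \<phi> :: "real \<Rightarrow> complex"
  assumes "0 < h"
    and d: "\<And>s. 0 \<le> s \<Longrightarrow> s \<le> h \<Longrightarrow> (\<phi> has_vector_derivative \<phi>' s) (at s)"
    and B: "\<And>s. 0 \<le> s \<Longrightarrow> s \<le> h \<Longrightarrow> norm (\<phi>' s) \<le> B"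
  shows "norm (\<phi> h - \<phi> 0) \<le> B * h"
proof -
  have "\<exists>x\<in>{0<..<h}. norm (\<phi> h - \<phi> 0) \<le> norm ((h - 0) *\<^sub>R \<phi>' x)"
  proof (rule mvt_general[OF \<open>0 < h\<close>, where f' = "\<lambda>x y. y *\<^sub>R \<phi>' x"])
    show "continuous_on {0..h} \<phi>"
      using d by (force intro!: continuous_at_imp_continuous_on has_vector_derivative_continuous)
  qed (use d in \<open>auto simp: has_vector_derivative_def\<close>)
  then obtain x where x: "0 < x" "x < h" "norm (\<phi> h - \<phi> 0) \<le> h * norm (\<phi>' x)"
    using \<open>0 < h\<close> by auto
  with B[of x] \<open>0 < h\<close> show ?thesis
    by (smt (verit, best) mult.commute mult_left_mono)
qed

text \<open>The mean value estimate is applied in direction \<open>u\<close> and then in direction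
  \<open>v\<close>. Linear terms with slopes \<open>of_real h * A\<close> and \<open>A\<close> are
  subtracted beforehand, so that only the deviation of the mixed derivative from \<open>A\<close>
  remains.\<close>

lemma second_difference_bound:
  fixes g :: "complex^'n \<Rightarrow> complex"
  assumes h: "0 < h"
    and in_U: "\<And>s r. 0 \<le> s \<Longrightarrow> s \<le> h \<Longrightarrow> 0 \<le> r \<Longrightarrow> r \<le> h \<Longrightarrow> x + s *\<^sub>R u + r *\<^sub>R v \<in> U"
    and d1: "\<And>y. y \<in> U \<Longrightarrow> g differentiable at y"
    and d2: "\<And>y. y \<in> U \<Longrightarrow> pd u g differentiable at y"
    and A: "\<And>y. y \<in> U \<Longrightarrow> norm (pd v (pd u g) y - A) \<le> e"
  shows "norm (g (x + h *\<^sub>R u + h *\<^sub>R v) - g (x + h *\<^sub>R u) - g (x + h *\<^sub>R v) + g x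
      - of_real (h^2) * A) \<le> e * h^2"
proof -
  define \<psi> where "\<psi> s = g ((x + h *\<^sub>R v) + s *\<^sub>R u) - g (x + s *\<^sub>R u) - s *\<^sub>R (of_real h * A)" for s
  define \<psi>' where "\<psi>' s = pd u g ((x + h *\<^sub>R v) + s *\<^sub>R u) - pd u g (x + s *\<^sub>R u) - of_real h * A" for s
  have eq: "(x + h *\<^sub>R v) + s *\<^sub>R u = x + s *\<^sub>R u + h *\<^sub>R v" for s
    by simp
  have "norm (\<psi> h - \<psi> 0) \<le> (e * h) * h"
  proof (rule norm_mvt_segment[OF h, where \<phi>' = \<psi>'])
    fix s assume s: "0 \<le> s" "s \<le> h"
    have "g differentiable at ((x + h *\<^sub>R v) + s *\<^sub>R u)" "g differentiable at (x + s *\<^sub>R u)"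
      using d1[OF in_U[OF s, of h]] d1[OF in_U[OF s, of 0]] h by (auto simp: eq)
    note D = this[THEN pd_line]
    show "(\<psi> has_vector_derivative \<psi>' s) (at s)"
      unfolding \<psi>_def \<psi>'_def
      by (rule has_vector_derivative_diff[OF has_vector_derivative_diff[OF D]])
        (auto intro!: derivative_eq_intros)
    define \<eta> where "\<eta> r = pd u g ((x + s *\<^sub>R u) + r *\<^sub>R v) - r *\<^sub>R A" for r
    have "norm (\<eta> h - \<eta> 0) \<le> e * h"
    proof (rule norm_mvt_segment[OF h])
      fix r assume r: "0 \<le> r" "r \<le> h"
      show "(\<eta> has_vector_derivative (pd v (pd u g) ((x + s *\<^sub>R u) + r *\<^sub>R v) - A)) (at r)"
        unfolding \<eta>_def
        by (rule has_vector_derivative_diff[OF pd_line[OF d2[OF in_U[OF s r]]]])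
          (auto intro!: derivative_eq_intros)
      show "norm (pd v (pd u g) ((x + s *\<^sub>R u) + r *\<^sub>R v) - A) \<le> e"
        by (rule A[OF in_U[OF s r]])
    qed
    moreover have "\<eta> h - \<eta> 0 = \<psi>' s"
      unfolding \<eta>_def \<psi>'_def by (simp add: scaleR_conv_of_real algebra_simps)
    ultimately show "norm (\<psi>' s) \<le> e * h" by simp
  qed
  moreover have "\<psi> h - \<psi> 0 = g (x + h *\<^sub>R u + h *\<^sub>R v) - g (x + h *\<^sub>R u) - g (x + h *\<^sub>R v) + g x
      - of_real (h^2) * A"
    unfolding \<psi>_def by (simp add: eq scaleR_conv_of_real power2_eq_square algebra_simps)
  ultimately show ?thesis by (simp add: power2_eq_square algebra_simps)
qed

section \<open>Calculus of C^k functions\<close>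

lemma Ck_on_imp_differentiable_at:
  assumes "Ck_on (Suc k) U g" "open U" "x \<in> U"
  shows "g differentiable at x"
  using assms by (simp add: differentiable_on_eq_differentiable_at)

lemma Ck_on_Suc_lower: "Ck_on (Suc k) U g \<Longrightarrow> Ck_on k U g"
proof (induction k arbitrary: g)
  case 0
  then show ?case by (simp add: differentiable_imp_continuous_on)
next
  case (Suc k)
  have "Ck_on k U (pd v g)" for v
    by (rule Suc.IH) (use Suc.prems in simp)
  with Suc.prems show ?case by simp
qed

lemma Ck_on_lower: "Ck_on k U g \<Longrightarrow> j \<le> k \<Longrightarrow> Ck_on j U g"
proof (induction k)
  case (Suc k)
  then show ?case using Ck_on_Suc_lower[of k U g] by (cases "j = Suc k") simp_all
qed simp

text \<open>\<open>Ck_on\<close> recurses through \<open>pd v g\<close> as a total function, whereas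
  the sum and product rules identify derivatives only at points of \<open>U\<close>. As
  \<open>U\<close> is open, this suffices.\<close>

lemma Ck_on_cong:
  assumes "open U" "\<And>x. x \<in> U \<Longrightarrow> g x = h x" "Ck_on k U g"
  shows "Ck_on k U h"
  using assms(2,3)
proof (induction k arbitrary: g h)
  case 0
  then show ?case using continuous_on_eq by auto
next
  case (Suc k)
  have "h differentiable_on U"
    unfolding differentiable_on_eq_differentiable_at[OF assms(1)]
  proof
    fix x assume "x \<in> U"
    then have "g differentiable at x"
      using Suc.prems assms(1) Ck_on_imp_differentiable_at by blast
    then show "h differentiable at x"
      unfolding differentiable_def
      using has_derivative_transform_within_open[OF _ assms(1) \<open>x \<in> U\<close>] Suc.prems(1) by blast
  qed
  moreover have "Ck_on k U (pd v h)" for v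
    by (rule Suc.IH[of "pd v g"]) (use Suc.prems in \<open>auto intro: pd_cong[OF assms(1)]\<close>)
  ultimately show ?case by simp
qed

lemma pd_lincomb:
  assumes "g differentiable at x" "h differentiable at x"
  shows "pd v (\<lambda>y. a * g y + b * h y) x = a * pd v g x + b * pd v h x"
proof -
  obtain g' h' where gh: "(g has_derivative g') (at x)" "(h has_derivative h') (at x)"
    using assms by (auto simp: differentiable_def)
  then have "((\<lambda>y. a * g y + b * h y) has_derivative (\<lambda>v. a * g' v + b * h' v)) (at x)"
    by (auto intro!: derivative_intros)
  with gh show ?thesis by (simp add: pd_eq_derivative)
qed

lemma pd_mult:
  assumes "g differentiable at x" "h differentiable at x"
  shows "pd v (\<lambda>y. g y * h y) x = g x * pd v h x + pd v g x * h x"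
proof -
  obtain g' h' where gh: "(g has_derivative g') (at x)" "(h has_derivative h') (at x)"
    using assms by (auto simp: differentiable_def)
  then have "((\<lambda>y. g y * h y) has_derivative (\<lambda>v. g x * h' v + g' v * h x)) (at x)"
    by (rule has_derivative_mult)
  from pd_eq_derivative[OF this] show ?thesis
    by (simp add: pd_eq_derivative[OF gh(1)] pd_eq_derivative[OF gh(2)])
qed

lemma Ck_on_lincomb:
  assumes "open U" "Ck_on k U g" "Ck_on k U h"
  shows "Ck_on k U (\<lambda>y. a * g y + b * h y)"
  using assms(2,3)
proof (induction k arbitrary: g h)
  case 0
  then show ?case by (auto intro!: continuous_intros)
next
  case (Suc k)
  have d: "g differentiable at x" "h differentiable at x" if "x \<in> U" for x
    using that Suc.prems assms(1) Ck_on_imp_differentiable_at by blast+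
  have "Ck_on k U (pd v (\<lambda>y. a * g y + b * h y))" for v
    by (rule Ck_on_cong[OF assms(1) _ Suc.IH[of "pd v g" "pd v h"]])
      (use d Suc.prems in \<open>auto simp: pd_lincomb\<close>)
  moreover have "(\<lambda>y. a * g y + b * h y) differentiable_on U"
    using Suc.prems by (intro differentiable_on_add differentiable_on_mult differentiable_on_const) simp_all
  ultimately show ?case by simp
qed

lemma Ck_on_mult:
  assumes "open U" "Ck_on k U g" "Ck_on k U h"
  shows "Ck_on k U (\<lambda>y. g y * h y)"
  using assms(2,3)
proof (induction k arbitrary: g h)
  case 0
  then show ?case by (auto intro!: continuous_intros)
next
  case (Suc k)
  have d: "g differentiable at x" "h differentiable at x" if "x \<in> U" for x
    using that Suc.prems assms(1) Ck_on_imp_differentiable_at by blast+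
  have "Ck_on k U (pd v (\<lambda>y. g y * h y))" for v
  proof (rule Ck_on_cong[OF assms(1)])
    show "Ck_on k U (\<lambda>y. 1 * (g y * pd v h y) + 1 * (pd v g y * h y))"
      using Suc.prems by (intro Ck_on_lincomb assms(1) Suc.IH) (auto intro: Ck_on_Suc_lower)
  qed (use d in \<open>auto simp: pd_mult\<close>)
  moreover have "(\<lambda>y. g y * h y) differentiable_on U"
    using Suc.prems by (intro differentiable_on_mult) simp_all
  ultimately show ?case by simp
qed

text \<open>The second difference is symmetric in \<open>u\<close> and \<open>v\<close>. Divided by
  h^2, it is within e of both mixed derivatives for small h, so these differ by at most 2 e for
  every e > 0.\<close>

lemma pd_commute:
  assumes "open U" "x \<in> U" "Ck_on 2 U g"
  shows "pd u (pd v g) x = pd v (pd u g) x"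
proof -
  have C2: "Ck_on (Suc (Suc 0)) U g" using assms(3) by (simp add: numeral_2_eq_2)
  have d1: "g differentiable at y" if "y \<in> U" for y
    using Ck_on_imp_differentiable_at[OF C2 assms(1) that] .
  have d2: "pd w g differentiable at y" if "y \<in> U" for y w
    using Ck_on_imp_differentiable_at[OF _ assms(1) that, of 0] C2 by simp
  have c: "continuous_on U (pd w (pd w' g))" for w w'
    using C2 by simp
  define A B where "A = pd v (pd u g) x" and "B = pd u (pd v g) x"
  have "norm (A - B) \<le> 2 * e" if "e > 0" for e
  proof -
    have near: "\<exists>d>0. \<forall>y\<in>U. dist y x < d \<longrightarrow> norm (pd w (pd w' g) y - pd w (pd w' g) x) \<le> e" for w w'
      using c[of w w'] assms(2) \<open>e > 0\<close> unfolding continuous_on_iff by (metis dist_norm less_imp_le)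
    obtain d1' where d1': "d1' > 0" "\<forall>y\<in>U. dist y x < d1' \<longrightarrow> norm (pd v (pd u g) y - A) \<le> e"
      using near unfolding A_def by blast
    obtain d2' where d2': "d2' > 0" "\<forall>y\<in>U. dist y x < d2' \<longrightarrow> norm (pd u (pd v g) y - B) \<le> e"
      using near unfolding B_def by blast
    obtain d3 where d3: "d3 > 0" "ball x d3 \<subseteq> U"
      using assms(1,2) open_contains_ball by blast
    define d where "d = min d1' (min d2' d3)"
    have "d > 0" using d1' d2' d3 by (simp add: d_def)
    define V where "V = ball x d"
    have VU: "V \<subseteq> U" using d3 by (auto simp: V_def d_def)
    have VA: "norm (pd v (pd u g) y - A) \<le> e" "norm (pd u (pd v g) y - B) \<le> e" if "y \<in> V" for y
      using that VU d1' d2' by (auto simp: V_def d_def dist_commute)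
    \<comment> \<open>The parallelogram spanned by \<open>h *\<^sub>R u\<close> and
      \<open>h *\<^sub>R v\<close> has to stay within distance \<open>d\<close> of \<open>x\<close>;
      the summand 1 keeps the denominator positive when both vectors are 0.\<close>
    define h where "h = d / (norm u + norm v + 1)"
    have n: "norm u + norm v + 1 > 0" by (smt (verit) norm_ge_zero)
    have h: "h > 0" using \<open>d > 0\<close> n by (simp add: h_def)
    have hd: "h * (norm u + norm v) < d"
    proof -
      have "h * (norm u + norm v + 1) = d" using n by (simp add: h_def)
      then show ?thesis using h by (simp add: algebra_simps)
    qed
    have inV: "x + s *\<^sub>R u + r *\<^sub>R v \<in> V" if "0 \<le> s" "s \<le> h" "0 \<le> r" "r \<le> h" for s r
    proof -
      have "norm (s *\<^sub>R u + r *\<^sub>R v) \<le> s * norm u + r * norm v"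
        using norm_triangle_ineq[of "s *\<^sub>R u" "r *\<^sub>R v"] that by simp
      also have "\<dots> \<le> h * norm u + h * norm v"
        using that by (intro add_mono mult_right_mono) auto
      finally show ?thesis
        using hd by (simp add: V_def dist_norm algebra_simps norm_minus_commute)
    qed
    have inV': "x + s *\<^sub>R v + r *\<^sub>R u \<in> V" if "0 \<le> s" "s \<le> h" "0 \<le> r" "r \<le> h" for s r
      using inV[of r s] that by (simp add: algebra_simps)
    define \<Delta> where "\<Delta> = g (x + h *\<^sub>R u + h *\<^sub>R v) - g (x + h *\<^sub>R u) - g (x + h *\<^sub>R v) + g x"
    have 1: "norm (\<Delta> - of_real (h^2) * A) \<le> e * h^2"
      unfolding \<Delta>_def
      by (rule second_difference_bound[OF h inV]) (use d1 d2 VU VA in auto)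
    have "norm (g (x + h *\<^sub>R v + h *\<^sub>R u) - g (x + h *\<^sub>R v) - g (x + h *\<^sub>R u) + g x
        - of_real (h^2) * B) \<le> e * h^2"
      by (rule second_difference_bound[OF h inV']) (use d1 d2 VU VA in auto)
    then have 2: "norm (\<Delta> - of_real (h^2) * B) \<le> e * h^2"
      unfolding \<Delta>_def by (simp add: algebra_simps)
    have "norm (of_real (h^2) * (A - B)) \<le> 2 * e * h^2"
      using norm_triangle_ineq4[of "\<Delta> - of_real (h^2) * B" "\<Delta> - of_real (h^2) * A"] 1 2
      by (simp add: algebra_simps)
    then have "h^2 * norm (A - B) \<le> h^2 * (2 * e)"
      by (simp add: norm_mult norm_power mult.commute)
    then show ?thesis using h by simp
  qed
  from this[of "norm (A - B) / 4"] have "A = B"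
    by (cases "A = B") auto
  then show ?thesis by (simp add: A_def B_def)
qed

section \<open>Taylor expansion in Wirtinger derivatives\<close>

text \<open>An index \<open>(j, False)\<close> stands for \<open>z\<^sub>j\<close> and \<open>(j, True)\<close> for its conjugate.\<close>

definition wirt :: "'n \<times> bool \<Rightarrow> (complex^'n \<Rightarrow> complex) \<Rightarrow> complex^'n \<Rightarrow> complex" where
  "wirt i = (if snd i then dzbar (fst i) else dz (fst i))"

definition wcoord :: "'n \<times> bool \<Rightarrow> complex^'n \<Rightarrow> complex" where
  "wcoord i z = (if snd i then cnj (z $ fst i) else z $ fst i)"

text \<open>The head acts first: removing it replaces \<open>g\<close> by its derivative, which is
  the shape of the induction in Taylor's formula.\<close>

fun wirt_list :: "('n \<times> bool) list \<Rightarrow> (complex^'n \<Rightarrow> complex) \<Rightarrow> complex^'n \<Rightarrow> complex" where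
  "wirt_list [] g = g"
| "wirt_list (i # L) g = wirt_list L (wirt i g)"

definition wmono :: "('n \<times> bool) list \<Rightarrow> complex^'n \<Rightarrow> complex" where
  "wmono L z = (\<Prod>i\<leftarrow>L. wcoord i z)"

lemma wirt_eq_lincomb:
  "wirt i g = (\<lambda>z. 1/2 * pd (axis (fst i) 1) g z
      + (if snd i then \<i>/2 else -\<i>/2) * pd (axis (fst i) \<i>) g z)"
  by (auto simp: wirt_def dz_def dzbar_def fun_eq_iff field_simps)

lemma Ck_on_wirt:
  assumes "open U" "Ck_on (Suc k) U g"
  shows "Ck_on k U (wirt i g)"
  unfolding wirt_eq_lincomb using assms by (intro Ck_on_lincomb) auto

lemma wirt_cong:
  assumes "open U" "x \<in> U" "\<And>y. y \<in> U \<Longrightarrow> g y = h y"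
  shows "wirt i g x = wirt i h x"
  using pd_cong[OF assms] by (simp add: wirt_eq_lincomb)

lemma wirt_list_cong:
  assumes "open U" "x \<in> U" "\<And>y. y \<in> U \<Longrightarrow> g y = h y"
  shows "wirt_list L g x = wirt_list L h x"
  using assms(3)
proof (induction L arbitrary: g h)
  case (Cons i L)
  have "wirt_list L (wirt i g) x = wirt_list L (wirt i h) x"
    by (rule Cons.IH) (rule wirt_cong[OF assms(1) _ Cons.prems])
  then show ?case by simp
qed (use assms(2) in simp)

lemma wirt_list_append: "wirt_list (L @ L') g = wirt_list L' (wirt_list L g)"
  by (induction L arbitrary: g) auto

section \<open>Symmetry of iterated Wirtinger derivatives\<close>

lemma wirt_commute:
  assumes "open U" "x \<in> U" "Ck_on 2 U g"
  shows "wirt i (wirt j g) x = wirt j (wirt i g) x"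
proof -
  have d: "pd v g differentiable at x" for v
    using assms Ck_on_imp_differentiable_at[of 0 U "pd v g" x] by (simp add: numeral_2_eq_2)
  have *: "pd v (wirt k g) x = 1/2 * pd v (pd (axis (fst k) 1) g) x
      + (if snd k then \<i>/2 else -\<i>/2) * pd v (pd (axis (fst k) \<i>) g) x" for v k
    unfolding wirt_eq_lincomb by (rule pd_lincomb[OF d d])
  show ?thesis
    unfolding wirt_eq_lincomb[of i "wirt j g"] wirt_eq_lincomb[of j "wirt i g"] *
    unfolding pd_commute[OF assms, of "axis (fst j) _" "axis (fst i) _"]
    by (simp add: algebra_simps)
qed

lemma wirt_list_move_front:
  assumes "open U" "x \<in> U" "Ck_on (length (ys @ i # zs)) U g"
  shows "wirt_list (ys @ i # zs) g x = wirt_list (i # ys @ zs) g x"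
  using assms(3)
proof (induction ys arbitrary: g)
  case (Cons y ys)
  have "Ck_on (length (ys @ i # zs)) U (wirt y g)"
    by (rule Ck_on_wirt[OF assms(1)]) (use Cons.prems in simp)
  then have "wirt_list ((y # ys) @ i # zs) g x = wirt_list (i # ys @ zs) (wirt y g) x"
    unfolding append_Cons wirt_list.simps(2)[of y] by (rule Cons.IH)
  also have "\<dots> = wirt_list (ys @ zs) (wirt i (wirt y g)) x" by simp
  \<comment> \<open>The exchange is made on all of \<open>U\<close>, not only at \<open>x\<close>,
    because the derivatives in \<open>ys @ zs\<close> are still to be taken.\<close>
  also have "\<dots> = wirt_list (ys @ zs) (wirt y (wirt i g)) x"
  proof (rule wirt_list_cong[OF assms(1,2)])
    show "wirt i (wirt y g) w = wirt y (wirt i g) w" if "w \<in> U" for w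
      by (rule wirt_commute[OF assms(1) that]) (rule Ck_on_lower[OF Cons.prems], simp)
  qed
  finally show ?case by simp
qed simp

text \<open>The head of \<open>L\<close> is moved to the front of \<open>L'\<close> and removed from
  both words. Needed because Taylor's formula produces words in every order, whereas
  \<open>taylor_coeff\<close> differentiates in a fixed one.\<close>

lemma wirt_list_mset_eq:
  assumes "open U" "x \<in> U" "Ck_on (length L) U g" "mset L = mset L'"
  shows "wirt_list L g x = wirt_list L' g x"
  using assms(3,4)
proof (induction L arbitrary: L' g)
  case (Cons i L)
  then have "i \<in> set L'" by (metis list.set_intros(1) mset_eq_setD)
  then obtain ys zs where L': "L' = ys @ i # zs" by (meson split_list)
  have m: "mset L = mset (ys @ zs)" using Cons.prems(2) L' by simp
  have len: "length (i # L) = length (ys @ i # zs)"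
    using Cons.prems(2) L' by (metis size_mset)
  have "wirt_list (i # L) g x = wirt_list (i # ys @ zs) g x"
    using Cons.IH[OF _ m, of "wirt i g"] Ck_on_wirt[OF assms(1)] Cons.prems(1) by simp
  also have "\<dots> = wirt_list L' g x"
    unfolding L' using Cons.prems(1) len by (intro wirt_list_move_front[OF assms(1,2), symmetric]) simp
  finally show ?case .
qed simp

text \<open>Real linearity expands the derivative in the basis \<open>axis j 1\<close>,
  \<open>axis j \<i>\<close>; regrouping the two directions of each coordinate gives its complex
  linear and antilinear parts.\<close>

lemma pd_eq_sum_wirt:
  fixes g :: "complex^'n \<Rightarrow> complex"
  assumes "g differentiable at x"
  shows "pd v g x = (\<Sum>i\<in>UNIV. wcoord i v * wirt i g x)"
proof -
  obtain g' where g': "(g has_derivative g') (at x)"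
    using assms by (auto simp: differentiable_def)
  interpret bounded_linear g' by (rule has_derivative_bounded_linear[OF g'])
  have v: "v = (\<Sum>j\<in>UNIV. Re (v $ j) *\<^sub>R axis j 1 + Im (v $ j) *\<^sub>R axis j \<i>)"
    by (simp add: vec_eq_iff axis_def if_distrib[of "\<lambda>a. _ *\<^sub>R a"] complex_eq_iff
        sum.delta sum.distrib cong: if_cong)
  have "g' v = (\<Sum>j\<in>UNIV. Re (v $ j) *\<^sub>R g' (axis j 1) + Im (v $ j) *\<^sub>R g' (axis j \<i>))"
    by (subst v) (simp add: sum add scaleR)
  also have "\<dots> = (\<Sum>j\<in>UNIV. \<Sum>b\<in>UNIV. wcoord (j, b) v * wirt (j, b) g x)"
    by (rule sum.cong)
      (auto simp: UNIV_bool wcoord_def wirt_eq_lincomb pd_eq_derivative[OF g']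
        complex_eq_iff field_simps)
  also have "\<dots> = (\<Sum>i\<in>UNIV. wcoord i v * wirt i g x)"
    by (simp add: sum.cartesian_product)
  finally show ?thesis by (simp add: pd_eq_derivative[OF g'])
qed

text \<open>The \<open>n\<close>-th Taylor term times n!. Summing over words instead of
  multi-indices keeps the recursion in \<open>n\<close> simple; multinomial coefficients reappear as
  numbers of words with given degrees.\<close>

definition taylor_form :: "nat \<Rightarrow> (complex^'n \<Rightarrow> complex) \<Rightarrow> complex^'n \<Rightarrow> complex" where
  "taylor_form n f z = (\<Sum>L | length L = n. wirt_list L f 0 * wmono L z)"

lemma taylor_form_0 [simp]: "taylor_form 0 f z = f 0"
  by (simp add: taylor_form_def wmono_def)

lemma taylor_form_Suc:
  "taylor_form (Suc n) f z = (\<Sum>i\<in>UNIV. wcoord i z * taylor_form n (wirt i f) z)"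
proof -
  have eq: "{L :: ('n \<times> bool) list. length L = Suc n}
      = (\<lambda>(i, L). i # L) ` (UNIV \<times> {L. length L = n})"
    by (auto simp: length_Suc_conv image_def)
  have "taylor_form (Suc n) f z
      = (\<Sum>(i, L)\<in>UNIV \<times> {L. length L = n}. wirt_list L (wirt i f) 0 * wmono (i # L) z)"
    unfolding taylor_form_def eq by (subst sum.reindex) (auto simp: inj_on_def case_prod_unfold)
  also have "\<dots> = (\<Sum>i\<in>UNIV. \<Sum>L | length L = n. wirt_list L (wirt i f) 0 * wmono (i # L) z)"
    by (simp add: sum.cartesian_product)
  finally show ?thesis
    by (simp add: taylor_form_def wmono_def sum_distrib_left mult_ac)
qed

lemma wcoord_scaleR: "wcoord i (s *\<^sub>R z) = of_real s * wcoord i z"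
  by (simp add: wcoord_def scaleR_conv_of_real[symmetric])

lemma norm_wcoord_le: "norm (wcoord i z) \<le> norm z"
  by (simp add: wcoord_def Finite_Cartesian_Product.norm_nth_le)

lemma taylor_form_scaleR: "taylor_form n f (s *\<^sub>R z) = of_real s ^ n * taylor_form n f z"
  by (induction n arbitrary: f) (auto simp: taylor_form_Suc wcoord_scaleR sum_distrib_left mult_ac)

text \<open>Induction on the order with \<open>f\<close> varying: along the segment from 0 to
  \<open>z\<close>, the derivative of the remainder of \<open>f\<close> of order N + 1 is the sum of
  the remainders of order N of the functions \<open>wirt i f\<close>, each times a coordinate of
  \<open>z\<close>. These coordinates supply the new factor \<open>norm z\<close>.\<close>

lemma taylor_wirtinger:
  fixes f :: "complex^'n \<Rightarrow> complex"
  assumes "open U" "0 \<in> U" "Ck_on N U f"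
  shows "\<exists>C r. 0 < r \<and> (\<forall>z. norm z < r \<longrightarrow>
    norm (f z - (\<Sum>n<N. taylor_form n f z / fact n)) \<le> C * norm z ^ N)"
  using assms(3)
proof (induction N arbitrary: f)
  case 0
  obtain r where r: "r > 0" "cball 0 r \<subseteq> U"
    using assms(1,2) open_contains_cball by blast
  have "compact (f ` cball 0 r)"
    using 0 r by (intro compact_continuous_image) (auto intro: continuous_on_subset)
  then obtain C where "\<And>z. z \<in> cball 0 r \<Longrightarrow> norm (f z) \<le> C"
    by (metis bounded_iff compact_imp_bounded image_eqI)
  with r(1) show ?case by (intro exI[of _ C] exI[of _ r]) auto
next
  case (Suc N)
  define R where "R g z = g z - (\<Sum>n<N. taylor_form n g z / fact n)" for g :: "complex^'n \<Rightarrow> complex" and z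
  have "\<exists>C r. 0 < r \<and> (\<forall>z. norm z < r \<longrightarrow> norm (R (wirt i f) z) \<le> C * norm z ^ N)" for i
    unfolding R_def by (rule Suc.IH) (rule Ck_on_wirt[OF assms(1) Suc.prems])
  then obtain C r where r: "\<And>i. 0 < r i"
    and C: "\<And>i z. norm z < r i \<Longrightarrow> norm (R (wirt i f) z) \<le> C i * norm z ^ N"
    by metis
  obtain r0 where r0: "r0 > 0" "ball 0 r0 \<subseteq> U"
    using assms(1,2) open_contains_ball by blast
  define \<rho> where "\<rho> = Min (insert r0 (range r))"
  have \<rho>: "\<rho> > 0" "\<rho> \<le> r0"
    using r r0 by (auto simp: \<rho>_def)
  have \<rho>_le: "\<rho> \<le> r i" for i
    unfolding \<rho>_def by (rule Min_le) auto
  define K where "K = (\<Sum>i\<in>UNIV. \<bar>C i\<bar>)"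
  have "norm (R f z - taylor_form N f z / fact N) \<le> K * norm z ^ Suc N" if z: "norm z < \<rho>" for z
  proof -
    define \<phi> where "\<phi> s = f (0 + s *\<^sub>R z) - (\<Sum>n<Suc N. s ^ n *\<^sub>R (taylor_form n f z / fact n))" for s
    define \<phi>' where "\<phi>' s = (\<Sum>i\<in>UNIV. wcoord i z * R (wirt i f) (s *\<^sub>R z))" for s
    have "norm (\<phi> 1 - \<phi> 0) \<le> (K * norm z ^ Suc N) * 1"
    proof (rule norm_mvt_segment[where \<phi>' = \<phi>'])
      fix s :: real assume s: "0 \<le> s" "s \<le> 1"
      have "norm (s *\<^sub>R z) \<le> norm z"
        using s by (simp add: mult_left_le_one_le)
      then have sz: "norm (s *\<^sub>R z) < \<rho>" using z by simp
      then have sU: "s *\<^sub>R z \<in> U" using \<rho> r0 by auto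
      have fd: "f differentiable at (0 + s *\<^sub>R z)"
        using Ck_on_imp_differentiable_at[OF Suc.prems assms(1) sU] by simp
      \<comment> \<open>The truncated \<open>n - 1\<close> is harmless at \<open>n = 0\<close>,
        where the factor \<open>of_nat n\<close> vanishes; the sum can therefore be shifted
        below.\<close>
      have D: "((\<lambda>s. \<Sum>n<Suc N. s ^ n *\<^sub>R (taylor_form n f z / fact n)) has_vector_derivative
          (\<Sum>n<Suc N. (of_nat n * s ^ (n - 1)) *\<^sub>R (taylor_form n f z / fact n))) (at s)"
        by (intro has_vector_derivative_sum) (auto intro!: derivative_eq_intros)
      have "(\<Sum>n<Suc N. (of_nat n * s ^ (n - 1)) *\<^sub>R (taylor_form n f z / fact n))
          = (\<Sum>n<N. (of_nat (Suc n) * s ^ n) *\<^sub>R (taylor_form (Suc n) f z / fact (Suc n)))"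
        by (subst sum.lessThan_Suc_shift) simp
      also have "\<dots> = (\<Sum>n<N. of_real s ^ n * taylor_form (Suc n) f z / fact n)"
      proof (rule sum.cong[OF refl])
        fix n
        have "(of_nat (Suc n) :: complex) \<noteq> 0" by (simp del: of_nat_Suc)
        then show "(of_nat (Suc n) * s ^ n) *\<^sub>R (taylor_form (Suc n) f z / fact (Suc n))
            = of_real s ^ n * taylor_form (Suc n) f z / fact n"
          by (simp add: scaleR_conv_of_real field_simps del: of_nat_Suc)
      qed
      also have "\<dots> = (\<Sum>n<N. \<Sum>i\<in>UNIV. wcoord i z * (taylor_form n (wirt i f) (s *\<^sub>R z) / fact n))"
        by (simp add: taylor_form_Suc taylor_form_scaleR sum_distrib_left sum_divide_distrib mult_ac)
      also have "\<dots> = (\<Sum>i\<in>UNIV. wcoord i z * (\<Sum>n<N. taylor_form n (wirt i f) (s *\<^sub>R z) / fact n))"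
        by (subst sum.swap) (simp add: sum_distrib_left)
      finally have eq: "(\<Sum>n<Suc N. (of_nat n * s ^ (n - 1)) *\<^sub>R (taylor_form n f z / fact n))
          = (\<Sum>i\<in>UNIV. wcoord i z * (\<Sum>n<N. taylor_form n (wirt i f) (s *\<^sub>R z) / fact n))" .
      have "pd z f (0 + s *\<^sub>R z)
          - (\<Sum>i\<in>UNIV. wcoord i z * (\<Sum>n<N. taylor_form n (wirt i f) (s *\<^sub>R z) / fact n)) = \<phi>' s"
        unfolding pd_eq_sum_wirt[OF fd] \<phi>'_def R_def
        by (simp add: sum_subtractf[symmetric] right_diff_distrib)
      with has_vector_derivative_diff[OF pd_line[OF fd] D]
      show "(\<phi> has_vector_derivative \<phi>' s) (at s)"
        unfolding \<phi>_def eq by simp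
      have "norm (\<phi>' s) \<le> (\<Sum>i\<in>UNIV. norm (wcoord i z) * norm (R (wirt i f) (s *\<^sub>R z)))"
        unfolding \<phi>'_def by (rule order_trans[OF norm_sum]) (simp add: norm_mult)
      also have "\<dots> \<le> (\<Sum>i\<in>UNIV. norm z * (\<bar>C i\<bar> * norm z ^ N))"
      proof (intro sum_mono mult_mono norm_wcoord_le)
        fix i
        have "norm (R (wirt i f) (s *\<^sub>R z)) \<le> C i * norm (s *\<^sub>R z) ^ N"
          using C[of "s *\<^sub>R z" i] sz \<rho>_le[of i] by simp
        also have "\<dots> \<le> \<bar>C i\<bar> * norm (s *\<^sub>R z) ^ N"
          by (intro mult_right_mono) auto
        also have "\<dots> \<le> \<bar>C i\<bar> * norm z ^ N"
          using \<open>norm (s *\<^sub>R z) \<le> norm z\<close> by (intro mult_left_mono power_mono) auto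
        finally show "norm (R (wirt i f) (s *\<^sub>R z)) \<le> \<bar>C i\<bar> * norm z ^ N" .
      qed auto
      also have "\<dots> = K * norm z ^ Suc N"
        by (simp add: K_def sum_distrib_left sum_distrib_right mult_ac)
      finally show "norm (\<phi>' s) \<le> K * norm z ^ Suc N" .
    qed simp
    moreover have "\<phi> 0 = 0"
      unfolding \<phi>_def by (subst sum.lessThan_Suc_shift) simp
    moreover have "\<phi> 1 = R f z - taylor_form N f z / fact N"
      by (simp add: \<phi>_def R_def)
    ultimately show ?thesis by simp
  qed
  then show ?case
    using \<rho>(1) unfolding R_def by (intro exI[of _ K] exI[of _ \<rho>]) (auto simp: algebra_simps)
qed

section \<open>Exponential expansions of holomorphic functions\<close>

text \<open>Multiplying by exp (- \<i> b \<theta>) makes the term of the new frequency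
  \<open>b\<close> constant, and differentiating removes it. Every other coefficient is only
  multiplied by the nonzero number \<i> (\<beta> - b), so the induction hypothesis applies; the
  coefficient of \<open>b\<close> is then read off at \<theta> = 0.\<close>

lemma imaginary_exponentials_independent:
  fixes c :: "real \<Rightarrow> complex"
  assumes "finite B" "\<And>\<theta>::real. (\<Sum>\<beta>\<in>B. c \<beta> * exp (\<i> * of_real \<beta> * of_real \<theta>)) = 0" "\<beta> \<in> B"
  shows "c \<beta> = 0"
  using assms
proof (induction B arbitrary: c \<beta> rule: finite_induct)
  case (insert b B)
  define G where "G w = (\<Sum>\<beta>\<in>insert b B. c \<beta> * exp (\<i> * of_real (\<beta> - b) * w))" for w :: complex
  define G' where "G' w = (\<Sum>\<beta>\<in>insert b B. c \<beta> * (exp (\<i> * of_real (\<beta> - b) * w) * (\<i> * of_real (\<beta> - b))))" for w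
  have "(G has_field_derivative G' w) (at w)" for w
    unfolding G_def G'_def by (intro DERIV_sum) (auto intro!: derivative_eq_intros)
  then have D: "((\<lambda>\<theta>. G (of_real \<theta>)) has_vector_derivative G' (of_real \<theta>)) (at \<theta>)" for \<theta> :: real
    by (intro has_vector_derivative_real_field)
  have split: "exp (\<i> * of_real (\<beta> - b) * w) = exp (\<i> * of_real \<beta> * w) * exp (- \<i> * of_real b * w)"
    for \<beta> w by (simp add: exp_add[symmetric] algebra_simps)
  have split': "exp (\<i> * of_real \<beta> * w) = exp (\<i> * of_real (\<beta> - b) * w) * exp (\<i> * of_real b * w)"
    for \<beta> w by (simp add: exp_add[symmetric] algebra_simps)
  have "G (of_real \<theta>) = (\<Sum>\<beta>\<in>insert b B. c \<beta> * exp (\<i> * of_real \<beta> * of_real \<theta>)) * exp (- \<i> * of_real b * of_real \<theta>)" for \<theta>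
    unfolding G_def split sum_distrib_right by (simp add: mult_ac)
  then have "G (of_real \<theta>) = 0" for \<theta> using insert.prems(1) by simp
  then have "G' (of_real \<theta>) = 0" for \<theta>
    using D[of \<theta>] by (auto intro: vector_derivative_unique_at)
  then have G'0: "(\<Sum>\<beta>\<in>B. c \<beta> * (exp (\<i> * of_real (\<beta> - b) * of_real \<theta>) * (\<i> * of_real (\<beta> - b)))) = 0" for \<theta>
    using insert.hyps unfolding G'_def by simp
  have "(\<Sum>\<beta>\<in>B. (c \<beta> * (\<i> * of_real (\<beta> - b))) * exp (\<i> * of_real \<beta> * of_real \<theta>)) = 0" for \<theta>
  proof -
    have "(\<Sum>\<beta>\<in>B. (c \<beta> * (\<i> * of_real (\<beta> - b))) * exp (\<i> * of_real \<beta> * of_real \<theta>))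
      = (\<Sum>\<beta>\<in>B. c \<beta> * (exp (\<i> * of_real (\<beta> - b) * of_real \<theta>) * (\<i> * of_real (\<beta> - b)))) * exp (\<i> * of_real b * of_real \<theta>)"
      unfolding sum_distrib_right
      by (rule sum.cong[OF refl]) (subst split', simp only: mult_ac)
    then show ?thesis using G'0 by simp
  qed
  then have cB: "c x = 0" if "x \<in> B" for x
    using insert.IH[of "\<lambda>\<beta>. c \<beta> * (\<i> * of_real (\<beta> - b))" x] that insert.hyps by auto
  moreover have "c b = 0"
    using insert.prems(1)[of 0] insert.hyps cB by simp
  ultimately show ?case using insert.prems(2) by auto
qed simp

definition biexp :: "real \<Rightarrow> real \<Rightarrow> complex \<Rightarrow> complex" where
  "biexp a b t = exp (- of_real a * t) * exp (- of_real b * cnj t)"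

lemma norm_biexp: "norm (biexp a b t) = exp (- (a + b) * Re t)"
  by (simp add: biexp_def norm_mult exp_add[symmetric] algebra_simps)

lemma exp_mult_biexp: "exp (of_real W * t) * biexp (W - b) b t = exp (\<i> * of_real (2 * b) * of_real (Im t))"
proof -
  have "of_real W * t + (- of_real (W - b) * t + - of_real b * cnj t) = \<i> * of_real (2 * b) * of_real (Im t)"
    by (simp add: complex_eq_iff algebra_simps)
  then show ?thesis by (simp add: biexp_def exp_add[symmetric])
qed

lemma open_right_half_plane: "open right_half_plane"
  unfolding right_half_plane_def by (rule open_halfspace_Re_gt)

text \<open>A trigonometric polynomial in \<open>Im t\<close> is invariant under real translations, so if it is a
  limit of a holomorphic function at \<open>Re t = \<infinity>\<close>, it is the locally uniform limit of its
  translates, hence holomorphic, hence constant.\<close>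

lemma holomorphic_limit_of_Im_constant:
  assumes hol: "G holomorphic_on right_half_plane"
    and lim: "\<And>e. e > 0 \<Longrightarrow> \<exists>s0. \<forall>t. s0 \<le> Re t \<and> 0 < Re t \<longrightarrow> norm (G t - p (Im t)) \<le> e"
  shows "\<exists>k. \<forall>\<theta>::real. p \<theta> = k"
proof -
  define h where "h t = p (Im t)" for t :: complex
  have "h holomorphic_on right_half_plane"
  proof (rule holomorphic_uniform_sequence[OF open_right_half_plane])
    show "(\<lambda>t. G (t + of_nat n)) holomorphic_on right_half_plane" for n :: nat
      using hol by (rule holomorphic_on_compose_gen[unfolded o_def, rotated])
        (auto simp: right_half_plane_def intro!: holomorphic_intros)
    fix x assume "x \<in> right_half_plane"
    then obtain d where d: "d > 0" "cball x d \<subseteq> right_half_plane"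
      using open_right_half_plane open_contains_cball by blast
    have "uniform_limit (cball x d) (\<lambda>n t. G (t + of_nat n)) h sequentially"
      unfolding uniform_limit_iff
    proof (intro allI impI)
      fix e :: real assume "e > 0"
      then obtain s0 where s0: "\<And>t. s0 \<le> Re t \<Longrightarrow> 0 < Re t \<Longrightarrow> norm (G t - p (Im t)) \<le> e/2"
        using lim[of "e/2"] by auto
      have "\<forall>t\<in>cball x d. dist (G (t + of_nat n)) (h t) < e" if "n \<ge> nat \<lceil>s0\<rceil>" for n
      proof
        fix t assume "t \<in> cball x d"
        then have "0 < Re t" using d by (auto simp: right_half_plane_def)
        moreover have "s0 \<le> of_nat n" using that by linarith
        ultimately show "dist (G (t + of_nat n)) (h t) < e"
          using s0[of "t + of_nat n"] \<open>e > 0\<close> by (simp add: h_def dist_norm)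
      qed
      then show "\<forall>\<^sub>F n in sequentially. \<forall>t\<in>cball x d. dist (G (t + of_nat n)) (h t) < e"
        using eventually_sequentially by blast
    qed
    with d show "\<exists>d>0. cball x d \<subseteq> right_half_plane \<and>
        uniform_limit (cball x d) (\<lambda>n t. G (t + of_nat n)) h sequentially" by blast
  qed
  have "(h has_field_derivative 0) (at t)" if t: "t \<in> right_half_plane" for t
  proof -
    obtain d where d: "(h has_field_derivative d) (at t)"
      using \<open>h holomorphic_on right_half_plane\<close> t open_right_half_plane
      by (metis holomorphic_on_open)
    \<comment> \<open>The complex derivative can be computed in the real direction, in which
      \<open>h\<close> does not change.\<close>
    have l: "((\<lambda>s::real. t + of_real s) has_vector_derivative 1) (at 0)"
      by (auto intro!: derivative_eq_intros)
    have "((h \<circ> (\<lambda>s::real. t + of_real s)) has_vector_derivative 1 * d) (at 0)"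
      by (rule field_vector_diff_chain_at[OF l]) (use d in simp)
    moreover have "h \<circ> (\<lambda>s::real. t + of_real s) = (\<lambda>s. h t)"
      by (auto simp: h_def)
    ultimately have "d = 0"
      by (auto dest: vector_derivative_unique_at[OF _ has_vector_derivative_const])
    with d show ?thesis by simp
  qed
  then obtain k where k: "\<And>t. t \<in> right_half_plane \<Longrightarrow> h t = k"
    using has_field_derivative_zero_constant[of right_half_plane h]
    by (metis convex_halfspace_Re_gt has_field_derivative_at_within right_half_plane_def)
  have "p \<theta> = k" for \<theta>
    using k[of "Complex 1 \<theta>"] by (simp add: h_def right_half_plane_def)
  then show ?thesis by blast
qed

text \<open>Among the nonzero coefficients violating the claim, take one of least total weight
  \<open>W\<close>. Once the terms with second exponent 0 are subtracted and exp (W t) is multiplied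
  in, the terms of weight \<open>W\<close> depend on \<open>Im t\<close> alone, heavier ones tend to
  0, and the error stays small because \<open>W \<le> D\<close>. So the oscillating part is
  constant, and independence of exponentials refutes the choice of \<open>W\<close>. The exponents
  may have any sign.\<close>

lemma holomorphic_biexp_expansion:
  fixes g :: "complex \<Rightarrow> complex" and a b :: "'i \<Rightarrow> real" and c :: "'i \<Rightarrow> complex"
  assumes hol: "g holomorphic_on right_half_plane" and "finite I"
    and err: "\<And>e. e > 0 \<Longrightarrow> \<exists>s0. \<forall>t. s0 \<le> Re t \<and> 0 < Re t \<longrightarrow>
      norm (g t - (\<Sum>i\<in>I. c i * biexp (a i) (b i) t)) \<le> e * exp (- D * Re t)"
    and "\<beta> \<noteq> 0" "\<alpha> + \<beta> \<le> D"
  shows "(\<Sum>i | i \<in> I \<and> a i = \<alpha> \<and> b i = \<beta>. c i) = 0"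
proof (rule ccontr)
  assume nz: "(\<Sum>i | i \<in> I \<and> a i = \<alpha> \<and> b i = \<beta>. c i) \<noteq> 0"
  \<comment> \<open>Several indices may share a pair of exponents, and only the sums of their
    coefficients are determined; hence the grouping by pairs.\<close>
  define Q where "Q = (\<lambda>i. (a i, b i)) ` I"
  define C where "C p = (\<Sum>i | i \<in> I \<and> a i = fst p \<and> b i = snd p. c i)" for p
  define E where "E p = biexp (fst p) (snd p)" for p
  have "finite Q" using \<open>finite I\<close> by (simp add: Q_def)
  have grp: "(\<Sum>i\<in>I. c i * biexp (a i) (b i) t) = (\<Sum>p\<in>Q. C p * E p t)" for t
  proof -
    have "(\<Sum>i\<in>I. c i * biexp (a i) (b i) t)
      = (\<Sum>p\<in>Q. \<Sum>i | i \<in> I \<and> (a i, b i) = p. c i * biexp (a i) (b i) t)"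
      unfolding Q_def by (rule sum.image_gen[OF \<open>finite I\<close>])
    also have "\<dots> = (\<Sum>p\<in>Q. C p * E p t)"
      by (rule sum.cong[OF refl]) (auto simp: C_def E_def sum_distrib_right intro!: sum.cong)
    finally show ?thesis .
  qed
  define Bad where "Bad = {p\<in>Q. snd p \<noteq> 0 \<and> fst p + snd p \<le> D \<and> C p \<noteq> 0}"
  have "C (\<alpha>, \<beta>) \<noteq> 0" using nz by (simp add: C_def)
  moreover have "(\<alpha>, \<beta>) \<in> Q"
  proof (rule ccontr)
    assume "(\<alpha>, \<beta>) \<notin> Q"
    then have "{i. i \<in> I \<and> a i = \<alpha> \<and> b i = \<beta>} = {}" by (auto simp: Q_def)
    then show False using nz by (metis sum.empty)
  qed
  ultimately have "(\<alpha>, \<beta>) \<in> Bad" using assms(4,5) by (simp add: Bad_def)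
  have "finite Bad" using \<open>finite Q\<close> by (simp add: Bad_def)
  define W where "W = Min ((\<lambda>p. fst p + snd p) ` Bad)"
  have "W \<in> (\<lambda>p. fst p + snd p) ` Bad"
    unfolding W_def using \<open>finite Bad\<close> \<open>(\<alpha>, \<beta>) \<in> Bad\<close> by (intro Min_in) auto
  then obtain p0 where p0: "p0 \<in> Bad" "W = fst p0 + snd p0" by blast
  have Wmin: "W \<le> fst p + snd p" if "p \<in> Bad" for p
    unfolding W_def using \<open>finite Bad\<close> that by (intro Min_le) auto
  have "W \<le> D" using p0 by (auto simp: Bad_def)
  define Hol Mid High where
    "Hol = {p\<in>Q. snd p = 0}" and "Mid = {p\<in>Q. snd p \<noteq> 0 \<and> fst p + snd p = W}" and
    "High = {p\<in>Q. snd p \<noteq> 0 \<and> fst p + snd p > W}"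
  have fin: "finite Hol" "finite Mid" "finite High"
    using \<open>finite Q\<close> by (auto simp: Hol_def Mid_def High_def)
  have split: "(\<Sum>p\<in>Q. C p * E p t) = (\<Sum>p\<in>Hol. C p * E p t) + (\<Sum>p\<in>Mid. C p * E p t) + (\<Sum>p\<in>High. C p * E p t)" for t
  proof -
    have "(\<Sum>p\<in>Q. C p * E p t) = (\<Sum>p\<in>(Hol \<union> Mid) \<union> High. C p * E p t)"
    proof (rule sum.mono_neutral_right[OF \<open>finite Q\<close>])
      show "\<forall>p\<in>Q - (Hol \<union> Mid \<union> High). C p * E p t = 0"
      proof
        fix p assume p: "p \<in> Q - (Hol \<union> Mid \<union> High)"
        then have "snd p \<noteq> 0" "fst p + snd p < W" by (auto simp: Hol_def Mid_def High_def)
        then have "C p = 0" using Wmin[of p] \<open>W \<le> D\<close> p by (auto simp: Bad_def)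
        then show "C p * E p t = 0" by simp
      qed
    qed (auto simp: Hol_def Mid_def High_def)
    also have "\<dots> = (\<Sum>p\<in>Hol \<union> Mid. C p * E p t) + (\<Sum>p\<in>High. C p * E p t)"
      by (rule sum.union_disjoint) (use fin in \<open>auto simp: Hol_def Mid_def High_def\<close>)
    also have "(\<Sum>p\<in>Hol \<union> Mid. C p * E p t) = (\<Sum>p\<in>Hol. C p * E p t) + (\<Sum>p\<in>Mid. C p * E p t)"
      by (rule sum.union_disjoint) (use fin in \<open>auto simp: Hol_def Mid_def High_def\<close>)
    finally show ?thesis .
  qed
  define B where "B = (\<lambda>p. 2 * snd p) ` Mid"
  \<comment> \<open>A pair in \<open>Mid\<close> has weight \<open>W\<close>, so its frequency
    \<open>x = 2 * snd p\<close> determines it; \<open>cc\<close> recovers the coefficient from the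
    frequency.\<close>
  define cc where "cc x = C (W - x/2, x/2)" for x
  define P where "P \<theta> = (\<Sum>x\<in>B. cc x * exp (\<i> * of_real x * of_real \<theta>))" for \<theta> :: real
  define G where "G t = exp (of_real W * t) * (g t - (\<Sum>p\<in>Hol. C p * E p t))" for t
  have inj: "inj_on (\<lambda>p. 2 * snd p) Mid"
    by (auto simp: inj_on_def Mid_def prod_eq_iff)
  have mid: "exp (of_real W * t) * (\<Sum>p\<in>Mid. C p * E p t) = P (Im t)" for t
  proof -
    have "P (Im t) = (\<Sum>p\<in>Mid. cc (2 * snd p) * exp (\<i> * of_real (2 * snd p) * of_real (Im t)))"
      unfolding P_def B_def by (simp add: sum.reindex[OF inj])
    also have "\<dots> = (\<Sum>p\<in>Mid. exp (of_real W * t) * (C p * E p t))"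
    proof (rule sum.cong[OF refl])
      fix p assume "p \<in> Mid"
      then have p: "fst p = W - snd p" by (auto simp: Mid_def)
      then have "(W - snd p, snd p) = p" by (simp add: prod_eq_iff)
      then have "cc (2 * snd p) = C p" by (simp add: cc_def)
      then show "cc (2 * snd p) * exp (\<i> * of_real (2 * snd p) * of_real (Im t)) = exp (of_real W * t) * (C p * E p t)"
        unfolding exp_mult_biexp[symmetric, of "snd p" t W] by (simp add: E_def p mult_ac)
    qed
    finally show ?thesis by (simp add: sum_distrib_left)
  qed
  have "\<exists>k. \<forall>\<theta>. P \<theta> = k"
  proof (rule holomorphic_limit_of_Im_constant)
    have "E p holomorphic_on right_half_plane" if "p \<in> Hol" for p
      using that unfolding E_def biexp_def Hol_def by (auto intro!: holomorphic_intros)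
    then show "G holomorphic_on right_half_plane"
      unfolding G_def using hol by (intro holomorphic_intros) auto
    fix e :: real assume "e > 0"
    then obtain s0 where s0: "\<And>t. s0 \<le> Re t \<Longrightarrow> 0 < Re t \<Longrightarrow>
        norm (g t - (\<Sum>p\<in>Q. C p * E p t)) \<le> e/2 * exp (- D * Re t)"
      using err[of "e/2"] unfolding grp by auto
    have "((\<lambda>s. \<Sum>p\<in>High. norm (C p) * exp (- (fst p + snd p - W) * s)) \<longlongrightarrow> (\<Sum>p\<in>High. norm (C p) * 0)) at_top"
    proof (intro tendsto_sum tendsto_mult tendsto_const)
      fix p assume "p \<in> High"
      then have "- (fst p + snd p - W) < 0" by (auto simp: High_def)
      then have "filterlim (\<lambda>s. - (fst p + snd p - W) * s) at_bot at_top"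
        by (intro filterlim_tendsto_neg_mult_at_bot[OF tendsto_const]) (auto intro: filterlim_ident)
      then show "((\<lambda>s. exp (- (fst p + snd p - W) * s)) \<longlongrightarrow> 0) at_top"
        by (rule filterlim_compose[OF exp_at_bot])
    qed
    then have "\<forall>\<^sub>F s in at_top. (\<Sum>p\<in>High. norm (C p) * exp (- (fst p + snd p - W) * s)) < e/2"
      using \<open>e > 0\<close> by (intro order_tendstoD(2)) auto
    then obtain s1 where s1: "\<And>s. s1 \<le> s \<Longrightarrow> (\<Sum>p\<in>High. norm (C p) * exp (- (fst p + snd p - W) * s)) < e/2"
      by (auto simp: eventually_at_top_linorder)
    show "\<exists>s0. \<forall>t. s0 \<le> Re t \<and> 0 < Re t \<longrightarrow> norm (G t - P (Im t)) \<le> e"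
    proof (intro exI[of _ "max s0 s1"] allI impI)
      fix t assume t: "max s0 s1 \<le> Re t \<and> 0 < Re t"
      define R where "R = g t - (\<Sum>p\<in>Q. C p * E p t)"
      have "G t - P (Im t) = exp (of_real W * t) * R + exp (of_real W * t) * (\<Sum>p\<in>High. C p * E p t)"
        unfolding G_def mid[symmetric] R_def split by (simp add: algebra_simps)
      then have "norm (G t - P (Im t)) \<le> norm (exp (of_real W * t) * R) + norm (exp (of_real W * t) * (\<Sum>p\<in>High. C p * E p t))"
        by (metis norm_triangle_ineq)
      moreover have "norm (exp (of_real W * t) * R) \<le> e/2"
      proof -
        have "norm (exp (of_real W * t) * R) = exp (W * Re t) * norm R"
          by (simp add: norm_mult)
        also have "\<dots> \<le> exp (W * Re t) * (e/2 * exp (- D * Re t))"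
          using s0[of t] t unfolding R_def by (intro mult_left_mono) auto
        also have "\<dots> = e/2 * exp ((W - D) * Re t)"
          by (simp add: exp_add[symmetric] algebra_simps mult_exp_exp)
        also have "\<dots> \<le> e/2 * 1"
          using \<open>W \<le> D\<close> t \<open>e > 0\<close> by (intro mult_left_mono) (auto simp: mult_le_0_iff)
        finally show ?thesis by simp
      qed
      moreover have "norm (exp (of_real W * t) * (\<Sum>p\<in>High. C p * E p t)) \<le> e/2"
      proof -
        have "norm (exp (of_real W * t) * (\<Sum>p\<in>High. C p * E p t))
            \<le> (\<Sum>p\<in>High. norm (exp (of_real W * t) * (C p * E p t)))"
          unfolding sum_distrib_left by (rule norm_sum)
        also have "\<dots> = (\<Sum>p\<in>High. norm (C p) * exp (- (fst p + snd p - W) * Re t))"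
          by (rule sum.cong) (auto simp: norm_mult E_def norm_biexp mult_exp_exp algebra_simps)
        also have "\<dots> \<le> e/2" using s1[of "Re t"] t by auto
        finally show ?thesis .
      qed
      ultimately show "norm (G t - P (Im t)) \<le> e" by simp
    qed
  qed
  then obtain k where k: "\<And>\<theta>. P \<theta> = k" by blast
  have B0: "0 \<notin> B" by (auto simp: B_def Mid_def)
  have "finite B" using fin by (simp add: B_def)
  \<comment> \<open>\<open>P = k\<close> becomes a vanishing sum once frequency 0 is adjoined with
    coefficient \<open>- k\<close>; this frequency is free because \<open>snd p\<close> is nonzero
    on \<open>Mid\<close>.\<close>
  define c' where "c' x = (if x = 0 then - k else cc x)" for x
  have "c' (2 * snd p0) = 0"
  proof (rule imaginary_exponentials_independent[of "insert 0 B"])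
    fix \<theta> :: real
    have "(\<Sum>x\<in>B. c' x * exp (\<i> * of_real x * of_real \<theta>)) = P \<theta>"
      unfolding P_def c'_def using B0 by (intro sum.cong) auto
    then show "(\<Sum>x\<in>insert 0 B. c' x * exp (\<i> * of_real x * of_real \<theta>)) = 0"
      using B0 \<open>finite B\<close> k by (simp add: c'_def)
    show "2 * snd p0 \<in> insert 0 B"
      using p0 by (auto simp: B_def Mid_def Bad_def)
  qed (use \<open>finite B\<close> in simp)
  moreover have "(W - snd p0, snd p0) = p0" using p0(2) by (simp add: prod_eq_iff)
  ultimately have "C p0 = 0" using p0 by (auto simp: c'_def cc_def Bad_def)
  then show False using p0 by (simp add: Bad_def)
qed

section \<open>Polynomials in \<open>z\<close> and its conjugate\<close>

definition zzbar_monom :: "('n::finite \<Rightarrow> nat) \<Rightarrow> ('n \<Rightarrow> nat) \<Rightarrow> complex^'n \<Rightarrow> complex" where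
  "zzbar_monom k m z = (\<Prod>i\<in>UNIV. z $ i ^ k i * cnj (z $ i) ^ m i)"

definition weight :: "real^'n \<Rightarrow> ('n::finite \<Rightarrow> nat) \<Rightarrow> real" where
  "weight lam k = (\<Sum>i\<in>UNIV. lam $ i * real (k i))"

lemma zzbar_monom_PhiX:
  fixes k m :: "'n::finite \<Rightarrow> nat"
  shows "zzbar_monom k m (PhiX lam z t) = zzbar_monom k m z * biexp (weight lam k) (weight lam m) t"
proof -
  have "exp (- of_real (weight lam k) * w) = (\<Prod>i\<in>UNIV. exp (- of_real (lam $ i) * w) ^ k i)" for k :: "'n \<Rightarrow> nat" and w :: complex
  proof -
    have "- of_real (weight lam k) * w = (\<Sum>i\<in>UNIV. of_nat (k i) * (- of_real (lam $ i) * w))"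
      by (simp add: weight_def sum_distrib_left sum_negf mult_ac)
    then show ?thesis by (simp only: exp_sum[OF finite] exp_of_nat_mult)
  qed
  then show ?thesis
    by (simp add: zzbar_monom_def PhiX_def biexp_def power_mult_distrib prod.distrib exp_cnj mult_ac)
qed

lemma quasi_hom_iff_biexp:
  "quasi_hom lam q d1 d2 \<longleftrightarrow> (\<forall>t\<in>right_half_plane. \<forall>z. q (PhiX lam z t) = biexp d1 d2 t * q z)"
  by (simp add: quasi_hom_def biexp_def)

lemma quasi_hom_prod:
  assumes "\<And>x. x \<in> X \<Longrightarrow> quasi_hom lam (q x) (d1 x) (d2 x)" "finite X"
  shows "quasi_hom lam (\<lambda>w. \<Prod>x\<in>X. q x w) (sum d1 X) (sum d2 X)"
  using assms by (auto simp: quasi_hom_def exp_sum sum_distrib_right sum_negf[symmetric] prod.distrib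
      simp del: sum_negf)

lemma zzbar_poly_iff:
  "zzbar_poly q \<longleftrightarrow> (\<exists>S c. finite S \<and> (\<forall>z. q z = (\<Sum>p\<in>S. c p * zzbar_monom (fst p) (snd p) z)))"
  by (simp add: zzbar_poly_def zzbar_monom_def case_prod_unfold)

text \<open>The definition sums over distinct exponent pairs, but products and Taylor words repeat
  them; the repetitions are collected here.\<close>

lemma zzbar_polyI:
  assumes "finite I" "\<And>z. q z = (\<Sum>i\<in>I. c i * zzbar_monom (K i) (M i) z)"
  shows "zzbar_poly q"
  unfolding zzbar_poly_iff
proof (intro exI conjI allI)
  show "finite ((\<lambda>i. (K i, M i)) ` I)" using assms(1) by simp
  fix z
  show "q z = (\<Sum>p\<in>(\<lambda>i. (K i, M i)) ` I. (\<Sum>i | i \<in> I \<and> (K i, M i) = p. c i) * zzbar_monom (fst p) (snd p) z)"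
    unfolding assms(2) sum.image_gen[OF assms(1), where g = "\<lambda>i. (K i, M i)"] sum_distrib_right
    by (intro sum.cong) auto
qed

lemma zzbar_monom_mult:
  "zzbar_monom k m z * zzbar_monom k' m' z = zzbar_monom (\<lambda>i. k i + k' i) (\<lambda>i. m i + m' i) z"
  by (simp add: zzbar_monom_def prod.distrib power_add mult_ac)

lemma zzbar_poly_mult:
  assumes "zzbar_poly p" "zzbar_poly q"
  shows "zzbar_poly (\<lambda>z. p z * q z)"
proof -
  obtain S c where S: "finite S" "\<And>z. p z = (\<Sum>x\<in>S. c x * zzbar_monom (fst x) (snd x) z)"
    using assms(1) unfolding zzbar_poly_iff by blast
  obtain S' c' where S': "finite S'" "\<And>z. q z = (\<Sum>x\<in>S'. c' x * zzbar_monom (fst x) (snd x) z)"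
    using assms(2) unfolding zzbar_poly_iff by blast
  show ?thesis
  proof (rule zzbar_polyI)
    show "finite (S \<times> S')" using S S' by simp
    show "p z * q z = (\<Sum>x\<in>S \<times> S'. (c (fst x) * c' (snd x)) *
       zzbar_monom (\<lambda>i. fst (fst x) i + fst (snd x) i) (\<lambda>i. snd (fst x) i + snd (snd x) i) z)" for z
      unfolding S(2) S'(2) sum_product sum.cartesian_product
      by (rule sum.cong) (auto simp: zzbar_monom_mult[symmetric])
  qed
qed

lemma zzbar_poly_one: "zzbar_poly (\<lambda>_. 1)"
  by (rule zzbar_polyI[of "{()}" _ "\<lambda>_. 1" "\<lambda>_ _. 0" "\<lambda>_ _. 0"]) (auto simp: zzbar_monom_def)

text \<open>The parameter is real, so conjugation acts only on the coefficients of the affine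
  factors.\<close>

lemma zzbar_poly_line:
  assumes "zzbar_poly q"
  obtains P :: "complex poly" where "\<And>s::real. q (x + s *\<^sub>R v) = poly P (of_real s)"
proof -
  obtain S c where S: "finite S" "\<And>z. q z = (\<Sum>p\<in>S. c p * zzbar_monom (fst p) (snd p) z)"
    using assms unfolding zzbar_poly_iff by blast
  show ?thesis
    by (rule that[of "\<Sum>p\<in>S. [:c p:] * (\<Prod>i\<in>UNIV. [:x $ i, v $ i:] ^ fst p i * [:cnj (x $ i), cnj (v $ i):] ^ snd p i)"])
      (simp add: S zzbar_monom_def poly_sum poly_prod scaleR_conv_of_real[symmetric])
qed

text \<open>On the real line through \<open>x\<close> and \<open>y\<close> both factors become
  nonzero polynomials in one variable, whose product has finitely many roots.\<close>

lemma zzbar_poly_mult_nonzero: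
  assumes "zzbar_poly p" "zzbar_poly q" "p x \<noteq> 0" "q y \<noteq> 0"
  shows "\<exists>w. p w * q w \<noteq> 0"
proof -
  obtain P where P: "\<And>s::real. p (x + s *\<^sub>R (y - x)) = poly P (of_real s)"
    using zzbar_poly_line[OF assms(1)] by blast
  obtain Q where Q: "\<And>s::real. q (x + s *\<^sub>R (y - x)) = poly Q (of_real s)"
    using zzbar_poly_line[OF assms(2)] by blast
  have "P \<noteq> 0" using P[of 0] assms(3) by auto
  moreover have "Q \<noteq> 0" using Q[of 1] assms(4) by auto
  ultimately have "finite {z. poly (P * Q) z = 0}"
    by (intro poly_roots_finite) simp
  moreover have "infinite (range (of_real :: real \<Rightarrow> complex))"
    by (meson finite_imageD infinite_UNIV_char_0 inj_of_real)
  ultimately obtain s :: real where "poly (P * Q) (of_real s) \<noteq> 0"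
    by (metis (mono_tags, lifting) finite_subset image_subsetI mem_Collect_eq)
  then show ?thesis using P[of s] Q[of s] by (metis poly_mult)
qed

lemma zzbar_poly_prod:
  assumes "finite X" "\<And>x. x \<in> X \<Longrightarrow> zzbar_poly (q x)" "\<And>x. x \<in> X \<Longrightarrow> \<exists>w. q x w \<noteq> 0"
  shows "zzbar_poly (\<lambda>w. \<Prod>x\<in>X. q x w) \<and> (\<exists>w. (\<Prod>x\<in>X. q x w) \<noteq> 0)"
  using assms
proof (induction X rule: finite_induct)
  case empty
  then show ?case by (simp add: zzbar_poly_one)
next
  case (insert x X)
  then have IH: "zzbar_poly (\<lambda>w. \<Prod>x\<in>X. q x w)" "\<exists>w. (\<Prod>x\<in>X. q x w) \<noteq> 0" by blast+
  have x: "zzbar_poly (q x)" "\<exists>w. q x w \<noteq> 0" using insert.prems by blast+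
  show ?case
    using zzbar_poly_mult[OF x(1) IH(1)] zzbar_poly_mult_nonzero[OF x(1) IH(1)] x(2) IH(2) insert.hyps
    by auto
qed

section \<open>Smoothness of polynomials\<close>

lemma Ck_on_const:
  fixes U :: "(complex^'n) set"
  shows "Ck_on k U (\<lambda>_. c)"
proof (induction k arbitrary: c)
  case (Suc k)
  have "pd v (\<lambda>_. c) = (\<lambda>_. 0)" for v :: "complex^'n"
    by (simp add: pd_def fun_eq_iff)
  with Suc show ?case by simp
qed simp

lemma wcoord_bounded_linear: "bounded_linear (wcoord i)"
proof (cases "snd i")
  case True
  then have "wcoord i = (\<lambda>z. cnj (z $ fst i))" by (auto simp: wcoord_def)
  then show ?thesis
    using bounded_linear_compose[OF bounded_linear_cnj bounded_linear_vec_nth] by simp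
next
  case False
  then have "wcoord i = (\<lambda>z. z $ fst i)" by (auto simp: wcoord_def)
  then show ?thesis using bounded_linear_vec_nth by simp
qed

lemma Ck_on_wcoord: "Ck_on k U (wcoord i)"
proof (cases k)
  case 0
  then show ?thesis using linear_continuous_on[OF wcoord_bounded_linear] by simp
next
  case (Suc k')
  have D: "(wcoord i has_derivative wcoord i) (at x within A)" for x A
    by (rule bounded_linear_imp_has_derivative[OF wcoord_bounded_linear])
  have "pd v (wcoord i) = (\<lambda>_. wcoord i v)" for v
    using pd_eq_derivative[OF D] by auto
  moreover have "wcoord i differentiable_on U"
    using D by (auto simp: differentiable_on_def differentiable_def)
  ultimately show ?thesis by (simp add: Suc Ck_on_const)
qed

lemma Ck_on_power: "open U \<Longrightarrow> Ck_on k U g \<Longrightarrow> Ck_on k U (\<lambda>z. g z ^ n)"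
proof (induction n)
  case 0
  then show ?case using Ck_on_const[of k U 1] by simp
next
  case (Suc n)
  then show ?case using Ck_on_mult[of U k g "\<lambda>z. g z ^ n"] by simp
qed

lemma Ck_on_prod:
  assumes "open U" "finite X" "\<And>x. x \<in> X \<Longrightarrow> Ck_on k U (g x)"
  shows "Ck_on k U (\<lambda>z. \<Prod>x\<in>X. g x z)"
  using assms(2,3)
proof (induction X rule: finite_induct)
  case empty
  then show ?case using Ck_on_const[of k U 1] by simp
next
  case (insert x X)
  then show ?case using Ck_on_mult[OF assms(1), of k "g x" "\<lambda>z. \<Prod>x\<in>X. g x z"] by simp
qed

lemma Ck_on_sum:
  assumes "open U" "finite X" "\<And>x. x \<in> X \<Longrightarrow> Ck_on k U (g x)"
  shows "Ck_on k U (\<lambda>z. \<Sum>x\<in>X. g x z)"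
  using assms(2,3)
proof (induction X rule: finite_induct)
  case empty
  then show ?case using Ck_on_const[of k U 0] by simp
next
  case (insert x X)
  then show ?case using Ck_on_lincomb[OF assms(1), of k "g x" "\<lambda>z. \<Sum>x\<in>X. g x z" 1 1] by simp
qed

lemma Ck_on_zzbar_poly:
  assumes "zzbar_poly q" "open U"
  shows "Ck_on k U q"
proof -
  obtain S c where S: "finite S" "\<And>z. q z = (\<Sum>p\<in>S. c p * zzbar_monom (fst p) (snd p) z)"
    using assms unfolding zzbar_poly_iff by blast
  have "Ck_on k U (\<lambda>z. z $ i)" "Ck_on k U (\<lambda>z. cnj (z $ i))" for i
    using Ck_on_wcoord[of k U "(i, False)"] Ck_on_wcoord[of k U "(i, True)"]
    by (simp_all add: wcoord_def[abs_def])
  then have "Ck_on k U (\<lambda>z. \<Sum>p\<in>S. c p * zzbar_monom (fst p) (snd p) z)"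
    unfolding zzbar_monom_def using assms(2) S(1)
    by (intro Ck_on_sum Ck_on_mult Ck_on_prod Ck_on_power Ck_on_const) auto
  moreover have "q = (\<lambda>z. \<Sum>p\<in>S. c p * zzbar_monom (fst p) (snd p) z)"
    using S(2) by auto
  ultimately show ?thesis by simp
qed

lemma smooth_at0_zzbar_poly: "zzbar_poly q \<Longrightarrow> smooth_at0 q"
  unfolding smooth_at0_def
  by (intro allI exI[of _ "ball 0 1"]) (auto intro: Ck_on_zzbar_poly)

text \<open>Finitely many hyperplanes through 0 form a null set and cannot cover the space.\<close>

lemma ex_vector_not_orthogonal:
  fixes V :: "(real^'n) set"
  assumes "finite V" "0 \<notin> V"
  shows "\<exists>\<mu>. \<forall>v\<in>V. v \<bullet> \<mu> \<noteq> 0"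
proof (rule ccontr)
  assume "\<nexists>\<mu>. \<forall>v\<in>V. v \<bullet> \<mu> \<noteq> 0"
  then have "(\<Union>v\<in>V. {\<mu>. v \<bullet> \<mu> = 0}) = UNIV" by auto
  moreover have "negligible (\<Union>v\<in>V. {\<mu>. v \<bullet> \<mu> = 0})"
    using assms by (intro negligible_Union) (auto intro!: negligible_hyperplane)
  ultimately show False by simp
qed

text \<open>Along \<open>z\<^sub>j = exp (- \<mu>\<^sub>j t)\<close> with generic \<open>\<mu>\<close> distinct monomials become distinct exponentials.\<close>

lemma zzbar_coeffs_eq_0:
  fixes K M :: "'i \<Rightarrow> 'n::finite \<Rightarrow> nat"
  assumes "finite I" "\<And>z. (\<Sum>i\<in>I. c i * zzbar_monom (K i) (M i) z) = 0" "m \<noteq> (\<lambda>_. 0)"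
  shows "(\<Sum>i | i \<in> I \<and> K i = k \<and> M i = m. c i) = 0"
proof -
  define vec :: "('n \<Rightarrow> nat) \<Rightarrow> real^'n" where "vec k = (\<chi> i. real (k i))" for k
  have vec_eq: "vec k = vec k' \<longleftrightarrow> k = k'" for k k'
    by (auto simp: vec_def vec_eq_iff fun_eq_iff)
  have vec0: "vec (\<lambda>_. 0) = 0" by (simp add: vec_def vec_eq_iff)
  \<comment> \<open>Genericity relative to the target: the first two families keep the weights of
    all other exponents away from those of \<open>k\<close> and \<open>m\<close>, and
    \<open>vec m\<close> makes the weight of \<open>m\<close> nonzero, as the expansion lemma
    demands of \<beta>.\<close>
  define V where "V = ((\<lambda>i. vec (K i) - vec k) ` I \<union> (\<lambda>i. vec (M i) - vec m) ` I \<union> {vec m}) - {0}"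
  have "finite V" using assms(1) by (simp add: V_def)
  then obtain \<mu> where \<mu>: "\<And>v. v \<in> V \<Longrightarrow> v \<bullet> \<mu> \<noteq> 0"
    using ex_vector_not_orthogonal[of V] by (auto simp: V_def)
  have w: "weight \<mu> k = vec k \<bullet> \<mu>" for k
    by (simp add: weight_def vec_def inner_vec_def mult.commute)
  have K: "weight \<mu> (K i) = weight \<mu> k \<longleftrightarrow> K i = k" and M: "weight \<mu> (M i) = weight \<mu> m \<longleftrightarrow> M i = m"
    if "i \<in> I" for i
    using \<mu>[of "vec (K i) - vec k"] \<mu>[of "vec (M i) - vec m"] that
    by (auto simp: w V_def vec_eq inner_diff_left)
  have "vec m \<noteq> 0" using vec_eq[of m "\<lambda>_. 0"] vec0 assms(3) by simp
  then have m0: "weight \<mu> m \<noteq> 0"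
    using \<mu>[of "vec m"] by (simp add: w V_def)
  have "(\<Sum>i | i \<in> I \<and> weight \<mu> (K i) = weight \<mu> k \<and> weight \<mu> (M i) = weight \<mu> m. c i) = 0"
  proof (rule holomorphic_biexp_expansion[where g = "\<lambda>_. 0" and D = "weight \<mu> k + weight \<mu> m"])
    fix e :: real assume "e > 0"
    have one: "zzbar_monom k m (\<chi> i. 1) = 1" for k m :: "'n \<Rightarrow> nat" by (simp add: zzbar_monom_def)
    have "(\<Sum>i\<in>I. c i * biexp (weight \<mu> (K i)) (weight \<mu> (M i)) t) = 0" for t
      using assms(2)[of "PhiX \<mu> (\<chi> i. 1) t"] by (simp add: zzbar_monom_PhiX one)
    then show "\<exists>s0. \<forall>t. s0 \<le> Re t \<and> 0 < Re t \<longrightarrow>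
        norm (0 - (\<Sum>i\<in>I. c i * biexp (weight \<mu> (K i)) (weight \<mu> (M i)) t))
        \<le> e * exp (- (weight \<mu> k + weight \<mu> m) * Re t)"
      using \<open>e > 0\<close> by simp
  qed (use assms(1) m0 in auto)
  moreover have "{i. i \<in> I \<and> weight \<mu> (K i) = weight \<mu> k \<and> weight \<mu> (M i) = weight \<mu> m}
      = {i. i \<in> I \<and> K i = k \<and> M i = m}"
    using K M by blast
  ultimately show ?thesis by simp
qed

text \<open>Along the flow through \<open>w\<close>, \<open>q\<close> is a combination of terms
  \<open>biexp\<close> whose second exponents are weights of multi-indices, hence nonnegative. None
  of them can match a negative \<open>d2\<close>.\<close>

lemma quasi_hom_bidegree_nonneg:
  fixes q :: "complex^'n \<Rightarrow> complex"
  assumes "zzbar_poly q" "quasi_hom lam q d1 d2" "q w \<noteq> 0" "\<forall>k. lam $ k > 0"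
  shows "d2 \<ge> 0"
proof (rule ccontr)
  assume neg: "\<not> d2 \<ge> 0"
  obtain S c where S: "finite S" "\<And>z. q z = (\<Sum>p\<in>S. c p * zzbar_monom (fst p) (snd p) z)"
    using assms(1) unfolding zzbar_poly_iff by blast
  \<comment> \<open>\<open>None\<close> stands for the term \<open>q w * biexp d1 d2 t\<close> moved
    to the other side, so that the whole family expands the zero function.\<close>
  define I where "I = insert None (Some ` S)"
  define c' where "c' = case_option (- q w) (\<lambda>p. c p * zzbar_monom (fst p) (snd p) w)"
  define a where "a = case_option d1 (\<lambda>p :: ('n \<Rightarrow> nat) \<times> ('n \<Rightarrow> nat). weight lam (fst p))"
  define b where "b = case_option d2 (\<lambda>p :: ('n \<Rightarrow> nat) \<times> ('n \<Rightarrow> nat). weight lam (snd p))"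
  have z: "(\<Sum>i\<in>I. c' i * biexp (a i) (b i) t) = 0" if "Re t > 0" for t
  proof -
    have "(\<Sum>i\<in>I. c' i * biexp (a i) (b i) t) = - q w * biexp d1 d2 t
       + (\<Sum>p\<in>S. c p * zzbar_monom (fst p) (snd p) w * biexp (weight lam (fst p)) (weight lam (snd p)) t)"
      unfolding I_def using S(1) by (simp add: c'_def a_def b_def sum.reindex)
    also have "\<dots> = - q w * biexp d1 d2 t + q (PhiX lam w t)"
      by (simp add: S(2)[of "PhiX lam w t"] zzbar_monom_PhiX mult.assoc)
    also have "\<dots> = 0"
      using assms(2) that by (simp add: quasi_hom_iff_biexp right_half_plane_def)
    finally show ?thesis .
  qed
  have "(\<Sum>i | i \<in> I \<and> a i = d1 \<and> b i = d2. c' i) = 0"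
  proof (rule holomorphic_biexp_expansion[where g = "\<lambda>_. 0" and D = "d1 + d2"])
    fix e :: real assume "e > 0"
    then show "\<exists>s0. \<forall>t. s0 \<le> Re t \<and> 0 < Re t \<longrightarrow>
        norm (0 - (\<Sum>i\<in>I. c' i * biexp (a i) (b i) t)) \<le> e * exp (- (d1 + d2) * Re t)"
      using z by (intro exI[of _ 0]) auto
  qed (use S(1) neg in \<open>auto simp: I_def\<close>)
  moreover have "weight lam k \<ge> 0" for k
    unfolding weight_def using assms(4) by (intro sum_nonneg) (simp add: less_imp_le)
  then have "{i. i \<in> I \<and> a i = d1 \<and> b i = d2} = {None}"
    using neg by (auto simp: I_def a_def b_def)
  ultimately show False using assms(3) by (simp add: c'_def)
qed

section \<open>Expansion along the leaves\<close>

definition hdeg :: "('n \<times> bool) list \<Rightarrow> 'n \<Rightarrow> nat" where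
  "hdeg L j = count_list L (j, False)"

definition adeg :: "('n \<times> bool) list \<Rightarrow> 'n \<Rightarrow> nat" where
  "adeg L j = count_list L (j, True)"

lemma wmono_eq_zzbar_monom: "wmono L z = zzbar_monom (hdeg L) (adeg L) z"
proof (induction L)
  case Nil
  then show ?case by (simp add: wmono_def zzbar_monom_def hdeg_def adeg_def)
next
  case (Cons i L)
  obtain j b where i: "i = (j, b)" by force
  have "zzbar_monom (hdeg (i # L)) (adeg (i # L)) z
      = (\<Prod>l\<in>UNIV. (if l = j then wcoord i z else 1) * (z $ l ^ hdeg L l * cnj (z $ l) ^ adeg L l))"
    unfolding zzbar_monom_def
    by (rule prod.cong) (auto simp: hdeg_def adeg_def i wcoord_def)
  also have "\<dots> = wcoord i z * zzbar_monom (hdeg L) (adeg L) z"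
    by (simp add: prod.distrib zzbar_monom_def)
  finally show ?case using Cons by (simp add: wmono_def)
qed

text \<open>The word along which \<open>wirt_iter\<close> differentiates. \<open>foldr\<close>
  applies the last index of the enumeration first, hence \<open>rev\<close>; the conjugate
  derivatives are the inner ones and come first.\<close>

definition idx_list :: "('n::finite \<Rightarrow> nat) \<Rightarrow> ('n \<Rightarrow> nat) \<Rightarrow> ('n \<times> bool) list" where
  "idx_list k m = concat (map (\<lambda>j. replicate (m j) (j, True)) (rev enum_idx))
     @ concat (map (\<lambda>j. replicate (k j) (j, False)) (rev enum_idx))"

lemma enum_idx: "distinct (enum_idx :: 'n::finite list)" "set (enum_idx :: 'n list) = UNIV"
proof -
  have "\<exists>xs :: 'n list. distinct xs \<and> set xs = UNIV"
    using finite_distinct_list[of "UNIV :: 'n set"] by auto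
  from someI_ex[OF this]
  show "distinct (enum_idx :: 'n list)" "set (enum_idx :: 'n list) = UNIV"
    by (simp_all add: enum_idx_def)
qed

lemma foldr_wirt_eq_wirt_list:
  "foldr (\<lambda>j h. (wirt (j, b) ^^ k j) h) xs g
    = wirt_list (concat (map (\<lambda>j. replicate (k j) (j, b)) (rev xs))) g"
proof (induction xs)
  case (Cons x xs)
  have "(wirt (x, b) ^^ n) h = wirt_list (replicate n (x, b)) h" for n h
    by (induction n arbitrary: h) (simp_all add: funpow_Suc_right del: funpow.simps(2))
  with Cons show ?case by (simp add: wirt_list_append)
qed simp

lemma wirt_iter_eq_wirt_list: "wirt_iter k m g = wirt_list (idx_list k m) g"
proof -
  have "dz j = wirt (j, False)" "dzbar j = wirt (j, True)" for j :: 'a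
    by (simp_all add: wirt_def)
  then show ?thesis
    by (simp add: wirt_iter_def idx_list_def wirt_list_append foldr_wirt_eq_wirt_list)
qed

lemma count_list_concat_replicate:
  fixes xs :: "'a list" and b b' :: 'b
  assumes "distinct xs"
  shows "count_list (concat (map (\<lambda>j. replicate (k j) (j, b)) xs)) (l, b')
    = (if b = b' \<and> l \<in> set xs then k l else 0)"
proof -
  have "count_list (replicate n x) y = (if x = y then n else 0)" for n :: nat and x y :: "'a \<times> 'b"
    by (induction n) auto
  with assms show ?thesis by (induction xs) auto
qed

lemma hdeg_idx_list: "hdeg (idx_list k m) = k" and adeg_idx_list: "adeg (idx_list k m) = m"
  by (auto simp: hdeg_def adeg_def idx_list_def fun_eq_iff count_list_concat_replicate enum_idx)

lemma mset_eq_if_deg_eq: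
  assumes "hdeg L = hdeg L'" "adeg L = adeg L'"
  shows "mset L = mset L'"
proof (rule multiset_eqI)
  fix x :: "'a \<times> bool"
  show "count (mset L) x = count (mset L') x"
    using fun_cong[OF assms(1), of "fst x"] fun_cong[OF assms(2), of "fst x"]
    by (cases x; cases "snd x") (auto simp: hdeg_def adeg_def count_mset)
qed

lemma wirt_list_eq_wirt_iter:
  assumes "smooth_at0 f"
  shows "wirt_list L f 0 = wirt_iter (hdeg L) (adeg L) f 0"
proof -
  obtain U where "open U" "0 \<in> U" "Ck_on (length L) U f"
    using assms unfolding smooth_at0_def by blast
  then show ?thesis
    unfolding wirt_iter_eq_wirt_list
    by (intro wirt_list_mset_eq mset_eq_if_deg_eq) (auto simp: hdeg_idx_list adeg_idx_list)
qed

lemma wirt_iter_eq_0_iff: "wirt_iter k m f 0 = 0 \<longleftrightarrow> taylor_coeff f k m = 0"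
  by (simp add: taylor_coeff_def)

lemma finite_lists_length_less: "finite {L :: ('n::finite \<times> bool) list. length L < N}"
proof (cases N)
  case (Suc n)
  then show ?thesis
    using finite_lists_length_le[of "UNIV :: ('n \<times> bool) set" n] by (simp add: less_Suc_eq_le)
qed simp

lemma sum_taylor_form:
  "(\<Sum>n<N. taylor_form n f z / fact n)
    = (\<Sum>L | length L < N. wirt_list L f 0 / fact (length L) * zzbar_monom (hdeg L) (adeg L) z)"
proof -
  have "(\<Sum>L | length L < N. wirt_list L f 0 / fact (length L) * zzbar_monom (hdeg L) (adeg L) z)
    = (\<Sum>n<N. \<Sum>L | L \<in> {L. length L < N} \<and> length L = n.
        wirt_list L f 0 / fact (length L) * zzbar_monom (hdeg L) (adeg L) z)"
    by (rule sum.group[symmetric]) (auto simp: finite_lists_length_less)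
  also have "\<dots> = (\<Sum>n<N. taylor_form n f z / fact n)"
    unfolding taylor_form_def sum_divide_distrib
    by (intro sum.cong) (auto simp: wmono_eq_zzbar_monom)
  finally show ?thesis by simp
qed

section \<open>Decay of the Taylor error along the flow\<close>

lemma norm_PhiX_le:
  assumes "\<And>k. \<mu> \<le> lam $ k" "0 \<le> Re t"
  shows "norm (PhiX lam z t) \<le> exp (- \<mu> * Re t) * norm z"
proof -
  have "norm (PhiX lam z t) \<le> norm (exp (- \<mu> * Re t) *\<^sub>R z)"
  proof (rule norm_le_componentwise_cart)
    fix i
    have "norm (z $ i) * exp (- (lam $ i) * Re t) \<le> norm (z $ i) * exp (- \<mu> * Re t)"
      using assms by (intro mult_left_mono) (simp_all add: mult_right_mono)
    then show "norm (PhiX lam z t $ i) \<le> norm ((exp (- \<mu> * Re t) *\<^sub>R z) $ i)"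
      by (simp add: PhiX_def norm_mult mult.commute)
  qed
  then show ?thesis by simp
qed

lemma leaf_expansion:
  fixes f :: "complex^'n \<Rightarrow> complex" and lam :: "real^'n"
  assumes "smooth_at0 f" "\<forall>k. lam $ k > 0"
  obtains N0 where "\<And>N z e. N \<ge> N0 \<Longrightarrow> e > 0 \<Longrightarrow> \<exists>s0. \<forall>t. s0 \<le> Re t \<and> 0 < Re t \<longrightarrow>
    norm (f (PhiX lam z t) - (\<Sum>L | length L < N. wirt_list L f 0 / fact (length L)
        * zzbar_monom (hdeg L) (adeg L) z * biexp (weight lam (hdeg L)) (weight lam (adeg L)) t))
      \<le> e * exp (- D * Re t)"
proof -
  define \<mu> where "\<mu> = Min (range (($) lam))"
  have "\<mu> \<in> range (($) lam)" unfolding \<mu>_def by (rule Min_in) auto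
  then have "\<mu> > 0" using assms(2) by auto
  have \<mu>_le: "\<mu> \<le> lam $ k" for k unfolding \<mu>_def by (rule Min_le) auto
  \<comment> \<open>The extra 1 leaves a factor exp (- Re t), which absorbs the constants and pushes
    the error below any \<open>e\<close>.\<close>
  obtain N0 :: nat where "(D + 1) / \<mu> \<le> N0" using real_arch_simple by blast
  then have N0: "D + 1 \<le> N0 * \<mu>" using \<open>\<mu> > 0\<close> by (simp add: field_simps)
  show ?thesis
  proof (rule that)
    fix N and z :: "complex^'n" and e :: real assume "N \<ge> N0" "e > 0"
    have N: "D + 1 \<le> N * \<mu>"
      using N0 \<open>N \<ge> N0\<close> \<open>\<mu> > 0\<close> by (smt (verit) mult_right_mono of_nat_mono)
    obtain U where U: "open U" "0 \<in> U" "Ck_on N U f"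
      using assms(1) unfolding smooth_at0_def by blast
    obtain C r where r: "r > 0" and C: "\<And>w. norm w < r \<Longrightarrow>
        norm (f w - (\<Sum>n<N. taylor_form n f w / fact n)) \<le> C * norm w ^ N"
      using taylor_wirtinger[OF U] by blast
    define A where "A = \<bar>C\<bar> * norm z ^ N"
    have lim: "((\<lambda>s. B * exp (- b * s)) \<longlongrightarrow> 0) at_top" if "b > 0" for b B :: real
    proof -
      have "filterlim (\<lambda>s. - b * s) at_bot at_top"
        using that by (intro filterlim_tendsto_neg_mult_at_bot[OF tendsto_const]) (auto intro: filterlim_ident)
      then have "((\<lambda>s. exp (- b * s)) \<longlongrightarrow> 0) at_top"
        by (rule filterlim_compose[OF exp_at_bot])
      then show ?thesis by (rule tendsto_mult_right_zero)
    qed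
    have "\<forall>\<^sub>F s in at_top. norm z * exp (- \<mu> * s) < r \<and> A * exp (- 1 * s) < e"
      using order_tendstoD(2)[OF lim[OF \<open>\<mu> > 0\<close>, of "norm z"] r]
        order_tendstoD(2)[OF lim[of 1 A] \<open>e > 0\<close>] by (auto intro: eventually_conj)
    then obtain s0 where s0: "\<And>s. s0 \<le> s \<Longrightarrow> norm z * exp (- \<mu> * s) < r"
      "\<And>s. s0 \<le> s \<Longrightarrow> A * exp (- s) < e"
      by (auto simp: eventually_at_top_linorder)
    show "\<exists>s0. \<forall>t. s0 \<le> Re t \<and> 0 < Re t \<longrightarrow>
      norm (f (PhiX lam z t) - (\<Sum>L | length L < N. wirt_list L f 0 / fact (length L)
          * zzbar_monom (hdeg L) (adeg L) z * biexp (weight lam (hdeg L)) (weight lam (adeg L)) t))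
        \<le> e * exp (- D * Re t)"
    proof (intro exI[of _ s0] allI impI)
      fix t assume t: "s0 \<le> Re t \<and> 0 < Re t"
      define w where "w = PhiX lam z t"
      have w: "norm w \<le> exp (- \<mu> * Re t) * norm z"
        unfolding w_def using t \<mu>_le by (intro norm_PhiX_le) auto
      then have wr: "norm w < r" using s0(1)[of "Re t"] t by (simp add: mult.commute)
      have "norm (f w - (\<Sum>n<N. taylor_form n f w / fact n)) \<le> C * norm w ^ N"
        by (rule C[OF wr])
      also have "\<dots> \<le> \<bar>C\<bar> * (exp (- \<mu> * Re t) * norm z) ^ N"
        using w by (intro mult_mono power_mono) auto
      also have "\<dots> = A * exp (- (N * \<mu>) * Re t)"
        by (simp add: A_def power_mult_distrib exp_of_nat_mult[symmetric] mult_ac)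
      also have "\<dots> \<le> A * exp (- (D + 1) * Re t)"
      proof (rule mult_left_mono)
        have "- (N * \<mu>) * Re t \<le> - (D + 1) * Re t"
          using N t by (intro mult_right_mono) auto
        then show "exp (- (N * \<mu>) * Re t) \<le> exp (- (D + 1) * Re t)" by simp
      qed (simp add: A_def)
      also have "\<dots> = (A * exp (- Re t)) * exp (- D * Re t)"
        by (simp add: exp_add[symmetric] algebra_simps mult_exp_exp)
      also have "\<dots> \<le> e * exp (- D * Re t)"
        using s0(2)[of "Re t"] t by (intro mult_right_mono) auto
      finally show "norm (f (PhiX lam z t) - (\<Sum>L | length L < N. wirt_list L f 0 / fact (length L)
          * zzbar_monom (hdeg L) (adeg L) z * biexp (weight lam (hdeg L)) (weight lam (adeg L)) t))
        \<le> e * exp (- D * Re t)"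
        unfolding sum_taylor_form w_def zzbar_monom_PhiX by (simp add: mult.assoc)
    qed
  qed
qed

section \<open>Formal Forelli suspensions\<close>

text \<open>The polynomial \<open>q\<close> below collects all Taylor terms of the bidegree of the
  monomial (k, m). Distinct monomials may share a bidegree, so once \<open>q\<close> vanishes
  identically, the coefficient of (k, m) is isolated by independence of the monomials.\<close>

lemma formal_forelli_if_nonsparse_leaf:
  fixes lam :: "real^'n" and F :: "(complex^'n) set"
  assumes lam: "\<forall>k. lam $ k > 0" and F: "F \<subseteq> sphere 0 1"
    and "z0 \<in> closure F" "nonsparse_leaf lam F z0"
  shows "formal_forelli lam F"
  unfolding formal_forelli_def
proof (intro allI impI)
  fix f :: "complex^'n \<Rightarrow> complex" and k m :: "'n \<Rightarrow> nat"
  assume f: "smooth_at0 f" and hol: "\<forall>z\<in>F. (\<lambda>t. f (PhiX lam z t)) holomorphic_on right_half_plane"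
    and m: "m \<noteq> (\<lambda>_. 0)"
  define d1 d2 where "d1 = weight lam k" and "d2 = weight lam m"
  have "d2 > 0"
  proof -
    obtain j where "m j \<noteq> 0" using m by (auto simp: fun_eq_iff)
    then show ?thesis
      unfolding d2_def weight_def using lam
      by (intro sum_pos2[of _ j]) (auto simp: less_imp_le)
  qed
  obtain N0 where N0: "\<And>N z e. N \<ge> N0 \<Longrightarrow> e > 0 \<Longrightarrow> \<exists>s0. \<forall>t. s0 \<le> Re t \<and> 0 < Re t \<longrightarrow>
    norm (f (PhiX lam z t) - (\<Sum>L | length L < N. wirt_list L f 0 / fact (length L)
        * zzbar_monom (hdeg L) (adeg L) z * biexp (weight lam (hdeg L)) (weight lam (adeg L)) t))
      \<le> e * exp (- (d1 + d2) * Re t)"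
    by (rule leaf_expansion[OF f lam, of "d1 + d2"]) blast
  \<comment> \<open>Large enough for the expansion and for \<open>idx_list k m\<close> to be among
    the words, which makes \<open>T\<close> nonempty.\<close>
  define N where "N = max N0 (Suc (length (idx_list k m)))"
  define I where "I = {L :: ('n \<times> bool) list. length L < N}"
  have "finite I" by (simp add: I_def finite_lists_length_less)
  define c where "c L = wirt_list L f 0 / fact (length L)" for L
  define J where "J = {L \<in> I. weight lam (hdeg L) = d1 \<and> weight lam (adeg L) = d2}"
  have "finite J" using \<open>finite I\<close> by (simp add: J_def)
  define q where "q z = (\<Sum>L\<in>J. c L * zzbar_monom (hdeg L) (adeg L) z)" for z
  have qF: "q z = 0" if "z \<in> F" for z
  proof -
    have "(\<Sum>L | L \<in> I \<and> weight lam (hdeg L) = d1 \<and> weight lam (adeg L) = d2.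
        c L * zzbar_monom (hdeg L) (adeg L) z) = 0"
    proof (rule holomorphic_biexp_expansion[where D = "d1 + d2"])
      show "(\<lambda>t. f (PhiX lam z t)) holomorphic_on right_half_plane" using hol that by blast
      fix e :: real assume "e > 0"
      then show "\<exists>s0. \<forall>t. s0 \<le> Re t \<and> 0 < Re t \<longrightarrow> norm (f (PhiX lam z t) -
          (\<Sum>L\<in>I. c L * zzbar_monom (hdeg L) (adeg L) z * biexp (weight lam (hdeg L)) (weight lam (adeg L)) t))
          \<le> e * exp (- (d1 + d2) * Re t)"
        unfolding I_def c_def by (intro N0) (auto simp: N_def)
    qed (use \<open>finite I\<close> \<open>d2 > 0\<close> in auto)
    then show ?thesis by (simp add: q_def J_def)
  qed
  have qpoly: "zzbar_poly q"
    by (rule zzbar_polyI[OF \<open>finite J\<close>]) (rule q_def)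
  have qhom: "quasi_hom lam q d1 d2"
    unfolding quasi_hom_iff_biexp q_def zzbar_monom_PhiX sum_distrib_left
    by (intro ballI allI sum.cong) (auto simp: J_def)
  have "continuous_on UNIV q" using Ck_on_zzbar_poly[OF qpoly, of UNIV 0] by simp
  then have "closed {w. q w = 0}"
    by (intro closed_Collect_eq) auto
  then have "closure F \<subseteq> {w. q w = 0}"
    using qF by (intro closure_minimal) auto
  moreover have "z0 \<in> sphere 0 1"
    using assms(3) closure_minimal[OF F closed_sphere] by blast
  ultimately have q0: "q w = 0" for w
    using assms(4)[unfolded nonsparse_leaf_def, rule_format, of "sphere 0 1" q d1 d2 w]
      qpoly qhom \<open>d2 > 0\<close> by (simp add: le_infI1)
  \<comment> \<open>By symmetry all words in \<open>T\<close> carry the same derivative, and they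
    have equal length; the vanishing sum is a positive multiple of that derivative.\<close>
  define T where "T = {L. L \<in> J \<and> hdeg L = k \<and> adeg L = m}"
  have "(\<Sum>L\<in>T. c L) = 0"
    unfolding T_def using q0 by (intro zzbar_coeffs_eq_0 \<open>finite J\<close> m) (simp add: q_def)
  moreover have "c L = wirt_iter k m f 0 / fact (length (idx_list k m))" if "L \<in> T" for L
  proof -
    have "hdeg L = k" "adeg L = m" using that by (auto simp: T_def)
    then have "mset L = mset (idx_list k m)"
      by (intro mset_eq_if_deg_eq) (simp_all add: hdeg_idx_list adeg_idx_list)
    then have "length L = length (idx_list k m)" by (rule mset_eq_length)
    with \<open>hdeg L = k\<close> \<open>adeg L = m\<close> show ?thesis
      by (simp add: c_def wirt_list_eq_wirt_iter[OF f])
  qed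
  ultimately have "of_nat (card T) * (wirt_iter k m f 0 / fact (length (idx_list k m))) = 0"
    by simp
  moreover have "card T > 0"
  proof -
    have "idx_list k m \<in> T"
      by (auto simp: T_def J_def I_def N_def hdeg_idx_list adeg_idx_list d1_def d2_def)
    moreover have "finite T" using \<open>finite J\<close> by (simp add: T_def)
    ultimately show ?thesis by (auto simp: card_gt_0_iff)
  qed
  ultimately show "taylor_coeff f k m = 0"
    using wirt_iter_eq_0_iff[of k m f] by simp
qed

text \<open>The roles in the expansion are exchanged: words with conjugates have coefficient 0, so
  the Taylor polynomial along the leaf is the holomorphic function, and
  \<open>q z * biexp d1 d2 t\<close> is its one-term expansion. No derivative of a polynomial has to
  be computed.\<close>

lemma quasi_hom_eq_0_if_formally_holomorphic:
  fixes lam :: "real^'n" and q :: "complex^'n \<Rightarrow> complex"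
  assumes lam: "\<forall>k. lam $ k > 0" and q: "smooth_at0 q" "quasi_hom lam q d1 d2" "d2 \<noteq> 0"
    and coeff: "\<And>k m. m \<noteq> (\<lambda>_. 0) \<Longrightarrow> taylor_coeff q k m = 0"
  shows "q z = 0"
proof -
  obtain N where N: "\<And>N' z e. N' \<ge> N \<Longrightarrow> e > 0 \<Longrightarrow> \<exists>s0. \<forall>t. s0 \<le> Re t \<and> 0 < Re t \<longrightarrow>
    norm (q (PhiX lam z t) - (\<Sum>L | length L < N'. wirt_list L q 0 / fact (length L)
        * zzbar_monom (hdeg L) (adeg L) z * biexp (weight lam (hdeg L)) (weight lam (adeg L)) t))
      \<le> e * exp (- (d1 + d2) * Re t)"
    by (rule leaf_expansion[OF q(1) lam, of "d1 + d2"]) blast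
  define g where "g t = (\<Sum>L | length L < N. wirt_list L q 0 / fact (length L)
        * zzbar_monom (hdeg L) (adeg L) z * biexp (weight lam (hdeg L)) (weight lam (adeg L)) t)" for t
  have "(\<Sum>i | i \<in> {()} \<and> d1 = d1 \<and> d2 = d2. q z) = 0"
  proof (rule holomorphic_biexp_expansion[where g = g and D = "d1 + d2"])
    show "g holomorphic_on right_half_plane"
      unfolding g_def
    proof (rule holomorphic_on_sum)
      fix L
      show "(\<lambda>t. wirt_list L q 0 / fact (length L) * zzbar_monom (hdeg L) (adeg L) z
          * biexp (weight lam (hdeg L)) (weight lam (adeg L)) t) holomorphic_on right_half_plane"
      proof (cases "adeg L = (\<lambda>_. 0)")
        case True
        then show ?thesis
          by (auto simp: weight_def biexp_def intro!: holomorphic_intros)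
      next
        case False
        then have "wirt_list L q 0 = 0"
          using coeff[OF False] wirt_iter_eq_0_iff[of "hdeg L" "adeg L" q]
          by (simp add: wirt_list_eq_wirt_iter[OF q(1), of L])
        then show ?thesis by simp
      qed
    qed
    fix e :: real assume "e > 0"
    from N[OF order_refl this, of z] obtain s0 where s0: "\<And>t. s0 \<le> Re t \<Longrightarrow> 0 < Re t \<Longrightarrow>
        norm (q (PhiX lam z t) - g t) \<le> e * exp (- (d1 + d2) * Re t)"
      unfolding g_def by blast
    have "q (PhiX lam z t) = q z * biexp d1 d2 t" if "0 < Re t" for t
      using q(2) that by (simp add: quasi_hom_iff_biexp right_half_plane_def mult.commute)
    then show "\<exists>s0. \<forall>t. s0 \<le> Re t \<and> 0 < Re t \<longrightarrow>
        norm (g t - (\<Sum>i\<in>{()}. q z * biexp d1 d2 t)) \<le> e * exp (- (d1 + d2) * Re t)"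
      using s0 by (intro exI[of _ s0]) (simp add: norm_minus_commute)
  qed (use q(3) in auto)
  then show ?thesis by simp
qed

lemma nonsparse_leaf_if_formal_forelli:
  fixes lam :: "real^'n" and F :: "(complex^'n) set"
  assumes lam: "\<forall>k. lam $ k > 0" and F: "F \<subseteq> sphere 0 1" "F \<noteq> {}"
    and forelli: "formal_forelli lam F"
  shows "\<exists>z\<in>closure F. nonsparse_leaf lam F z"
proof (rule ccontr)
  assume none: "\<not> ?thesis"
  have clF: "closure F \<subseteq> sphere 0 1" by (rule closure_minimal[OF F(1) closed_sphere])
  \<comment> \<open>The neighborhoods are taken open in the ambient space, ready for compactness;
    this is harmless as \<open>closure F\<close> lies in the sphere.\<close>
  define sparse where "sparse z T q d1 d2 \<longleftrightarrow> open T \<and> z \<in> T \<and> zzbar_poly q \<and>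
      quasi_hom lam q d1 d2 \<and> d2 \<noteq> 0 \<and> closure F \<inter> T \<subseteq> {w. q w = 0} \<and> (\<exists>w. q w \<noteq> 0)"
    for z T q d1 d2
  have "\<exists>T q d1 d2. sparse z T q d1 d2" if z: "z \<in> closure F" for z
  proof -
    have "\<not> nonsparse_leaf lam F z" using none z by blast
    then obtain U q d1 d2 where U: "openin (top_of_set (sphere 0 1)) U" "z \<in> U"
      and q: "zzbar_poly q" "quasi_hom lam q d1 d2" "d2 \<noteq> 0" "closure F \<inter> U \<subseteq> {w. q w = 0}" "\<exists>w. q w \<noteq> 0"
      unfolding nonsparse_leaf_def by blast
    obtain T where T: "open T" "U = sphere 0 1 \<inter> T" using U(1) by (auto simp: openin_open)
    have "closure F \<inter> T \<subseteq> {w. q w = 0}" using q(4) clF T by blast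
    moreover have "z \<in> T" using T U(2) by blast
    ultimately have "sparse z T q d1 d2" using T(1) q by (simp add: sparse_def)
    then show ?thesis by blast
  qed
  then obtain T q d1 d2 where sp: "\<And>z. z \<in> closure F \<Longrightarrow> sparse z (T z) (q z) (d1 z) (d2 z)"
    by metis
  have T: "open (T z)" "z \<in> T z"
    and q: "zzbar_poly (q z)" "quasi_hom lam (q z) (d1 z) (d2 z)" "d2 z \<noteq> 0"
      "closure F \<inter> T z \<subseteq> {w. q z w = 0}" "\<exists>w. q z w \<noteq> 0" if "z \<in> closure F" for z
    using sp[OF that] by (simp_all add: sparse_def)
  have "bounded F" using F(1) bounded_sphere bounded_subset by blast
  then have "compact (closure F)" by (simp add: compact_closure)
  then obtain Z where Z: "Z \<subseteq> closure F" "finite Z" "closure F \<subseteq> (\<Union>z\<in>Z. T z)"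
    by (rule compactE_image[of _ "closure F" T]) (use T in auto)
  \<comment> \<open>Otherwise \<open>p\<close> would be the empty product 1, of bidegree (0,
    0).\<close>
  have "Z \<noteq> {}" using Z(3) F(2) closure_subset by fastforce
  define p where "p w = (\<Prod>z\<in>Z. q z w)" for w
  have p: "zzbar_poly p" "\<exists>w. p w \<noteq> 0"
    using zzbar_poly_prod[OF Z(2), of q] q(1,5) Z(1) unfolding p_def by blast+
  have phom: "quasi_hom lam p (sum d1 Z) (sum d2 Z)"
    unfolding p_def using q(2) Z by (intro quasi_hom_prod) auto
  \<comment> \<open>Nonzero entries alone could cancel in \<open>sum d2 Z\<close>; positive ones
    cannot.\<close>
  have "d2 z > 0" if "z \<in> Z" for z
  proof -
    have z: "z \<in> closure F" using that Z(1) by blast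
    from q(5)[OF z] obtain w where "q z w \<noteq> 0" ..
    from quasi_hom_bidegree_nonneg[OF q(1,2)[OF z] this lam] q(3)[OF z] show ?thesis by simp
  qed
  then have "sum d2 Z > 0" using Z(2) \<open>Z \<noteq> {}\<close> by (intro sum_pos) auto
  have pF: "p w = 0" if w: "w \<in> closure F" for w
  proof -
    obtain z where "z \<in> Z" "w \<in> T z" using Z(3) w by blast
    then have "q z w = 0" using q(4)[of z] Z(1) w by blast
    then show ?thesis unfolding p_def using \<open>z \<in> Z\<close> Z(2) by auto
  qed
  have "(\<lambda>t. p (PhiX lam z t)) holomorphic_on right_half_plane" if "z \<in> F" for z
  proof (rule holomorphic_transform[of "\<lambda>_. 0"])
    have "p z = 0" using pF that closure_subset by blast
    then show "0 = p (PhiX lam z t)" if "t \<in> right_half_plane" for t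
      using phom that by (simp add: quasi_hom_iff_biexp)
  qed simp
  then have "taylor_coeff p k m = 0" if "m \<noteq> (\<lambda>_. 0)" for k m
    using forelli smooth_at0_zzbar_poly[OF p(1)] that unfolding formal_forelli_def by blast
  then have "p w = 0" for w
    using quasi_hom_eq_0_if_formally_holomorphic[OF lam smooth_at0_zzbar_poly[OF p(1)] phom]
      \<open>sum d2 Z > 0\<close> by simp
  with p(2) show False by blast
qed

theorem theorem3p1:
  fixes lam :: "real^'n" and i1 :: 'n and F :: "(complex^'n) set"
  assumes "lam $ i1 = 1"
    and "\<forall>k. lam $ k > 0"
    and "F \<subseteq> sphere 0 1"
    and "F \<noteq> {}"
  shows "formal_forelli lam F \<longleftrightarrow> (\<exists>z\<in>closure F. nonsparse_leaf lam F z)"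
  using formal_forelli_if_nonsparse_leaf[OF assms(2,3)]
    nonsparse_leaf_if_formal_forelli[OF assms(2-4)] by blast

end
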